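(* Let $k$ be a field. For every non-increasing function $f\colon \mathbb{N}_{\ge1} \to \mathbb{N}$ there exist a polynomial ring $R$ over $k$ and a monomial ideal $Q\subset R$ such that $\operatorname{depth} R/Q^n = f(n)$ for all $n \ge 1$.
   Context: Depth is taken with respect to the maximal homogeneous ideal of $R$ (standard grading). *)

theory Defs
  imports "HOL-Library.Poly_Mapping" "HOL-Library.Extended_Nat"
begin

text \<open>Polynomials over a field 'k in the variables x_0, x_1, ... : finitely supported
  maps from exponent vectors to coefficients, with convolution product.
  The polynomial ring k[x_0,...,x_(N-1)] is the subring of those polynomials all of whose
  monomials only involve variables with index < N.\<close>

type_synonym 'k mpoly = "(nat \<Rightarrow>\<^sub>0 nat) \<Rightarrow>\<^sub>0 'k"

definition polyring :: "nat \<Rightarrow> 'k::field mpoly set" where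
  "polyring N = {p. \<forall>a \<in> Poly_Mapping.keys p. Poly_Mapping.keys a \<subseteq> {..<N}}"

definition var :: "nat \<Rightarrow> 'k::field mpoly" where
  "var i = Poly_Mapping.single (Poly_Mapping.single i 1) 1"

definition monom :: "(nat \<Rightarrow>\<^sub>0 nat) \<Rightarrow> 'k::field mpoly" where
  "monom a = Poly_Mapping.single a 1"

definition is_ideal :: "nat \<Rightarrow> 'k::field mpoly set \<Rightarrow> bool" where
  "is_ideal N I \<longleftrightarrow> I \<subseteq> polyring N \<and> 0 \<in> I
     \<and> (\<forall>x\<in>I. \<forall>y\<in>I. x + y \<in> I)
     \<and> (\<forall>r\<in>polyring N. \<forall>x\<in>I. r * x \<in> I)"

definition ideal_gen :: "nat \<Rightarrow> 'k::field mpoly set \<Rightarrow> 'k mpoly set" where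
  "ideal_gen N S = \<Inter>{I. is_ideal N I \<and> S \<subseteq> I}"

definition monomial_ideal :: "nat \<Rightarrow> 'k::field mpoly set \<Rightarrow> bool" where
  "monomial_ideal N Q \<longleftrightarrow>
     (\<exists>A. (\<forall>a\<in>A. Poly_Mapping.keys a \<subseteq> {..<N}) \<and> Q = ideal_gen N (monom ` A))"

fun ideal_pow :: "nat \<Rightarrow> 'k::field mpoly set \<Rightarrow> nat \<Rightarrow> 'k mpoly set" where
  "ideal_pow N Q 0 = polyring N"
| "ideal_pow N Q (Suc n) = ideal_gen N {a * b | a b. a \<in> ideal_pow N Q n \<and> b \<in> Q}"

definition max_hom_ideal :: "nat \<Rightarrow> 'k::field mpoly set" where
  "max_hom_ideal N = ideal_gen N (var ` {..<N})"

definition ideal_colon :: "nat \<Rightarrow> 'k::field mpoly set \<Rightarrow> 'k mpoly \<Rightarrow> 'k mpoly set" where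
  "ideal_colon N I f = {g \<in> polyring N. g * f \<in> I}"

text \<open>fs = [f_1,...,f_d] is a regular sequence in the maximal homogeneous ideal on the module
  M = R/I: each f_i lies in m, f_i is a nonzerodivisor on M/(f_1..f_{i-1})M = R/(I+(f_1..f_{i-1})),
  and M/(f_1..f_d)M \<noteq> 0.\<close>
definition regular_seq :: "nat \<Rightarrow> 'k::field mpoly set \<Rightarrow> 'k mpoly list \<Rightarrow> bool" where
  "regular_seq N I fs \<longleftrightarrow>
     set fs \<subseteq> max_hom_ideal N
     \<and> (\<forall>i < length fs.
          ideal_colon N (ideal_gen N (I \<union> set (take i fs))) (fs ! i)
            = ideal_gen N (I \<union> set (take i fs)))
     \<and> ideal_gen N (I \<union> set fs) \<noteq> polyring N"

definition depth_quot :: "nat \<Rightarrow> 'k::field mpoly set \<Rightarrow> enat" where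
  "depth_quot N I =
     (if I = polyring N then \<infinity>
      else (SUP fs \<in> {fs. regular_seq N I fs}. enat (length fs)))"

end

theory Submission
  imports Defs
begin

text \<open>
  For thresholds \<open>m\<^sub>j\<close> take \<open>Q\<^sub>j = (x\<^sub>j^m\<^sub>j, x\<^sub>j^(m\<^sub>j-1) y, y^(m\<^sub>j-1) t\<^sub>j)\<close>, and let \<open>Q\<close> be the product of the
  \<open>Q\<^sub>j\<close>, which share only the variable \<open>y\<close>. As long as \<open>n < m\<^sub>j\<close>, the part of \<open>Q\<^sub>j^n\<close> in each
  \<open>x\<^sub>j\<close>-degree is principal, and this makes \<open>t\<^sub>j - y\<close> regular on \<open>R/Q^n\<close>, even after some of the other
  \<open>t\<^sub>i\<close> have been identified with \<open>y\<close>. From \<open>n = m\<^sub>j\<close> on, the part of \<open>Q\<^sub>j^n\<close> in \<open>x\<^sub>j\<close>-degree \<open>(n-1) m\<^sub>j\<close>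
  is the ideal \<open>y^(m\<^sub>j-1) (y, t\<^sub>j)\<close>. Multiplying the generators of the corresponding socles one finds a
  monomial \<open>u\<close> that survives the identification of the \<open>t\<^sub>j\<close> with \<open>n < m\<^sub>j\<close> and is killed in
  \<open>R/Q^n\<close> by all remaining variables. Hence \<open>u\<close> gives a nonzero Koszul cohomology class, and
  the depth of \<open>R/Q^n\<close> is the number of \<open>j\<close> with \<open>n < m\<^sub>j\<close>. Choosing \<open>m\<^sub>j\<close> for \<open>j \<le> f 1\<close> as the
  least \<open>n \<ge> 1\<close> with \<open>f n \<le> j\<close> (or \<open>Q\<^sub>j = (x\<^sub>j, y)\<close> if there is none) yields \<open>f\<close>.
\<close>

section \<open>Koszul cochains on lists of indices\<close>

text \<open>Cochains are not required to be alternating. This makes the Cartan homotopy formula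
  the defining equation of the differential, so no signs have to be tracked.\<close>

primrec koszul_d :: "(nat \<Rightarrow> 'a::comm_ring_1) \<Rightarrow> nat list \<Rightarrow> (nat list \<Rightarrow> 'a) \<Rightarrow> 'a" where
  "koszul_d z [] w = 0"
| "koszul_d z (i # l) w = z i * w l - koszul_d z l (\<lambda>l'. w (i # l'))"

lemma koszul_d_zero [simp]: "koszul_d z l (\<lambda>_. 0) = 0"
  by (induction l) auto

lemma koszul_d_add: "koszul_d z l (\<lambda>l'. w l' + w' l') = koszul_d z l w + koszul_d z l w'"
  by (induction l arbitrary: w w') (auto simp: algebra_simps)

lemma koszul_d_diff: "koszul_d z l (\<lambda>l'. w l' - w' l') = koszul_d z l w - koszul_d z l w'"
  by (induction l arbitrary: w w') (auto simp: algebra_simps)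

lemma koszul_d_mult: "koszul_d z l (\<lambda>l'. c * w l') = c * koszul_d z l w"
  by (induction l arbitrary: w) (auto simp: algebra_simps)

lemma koszul_d_sum: "koszul_d z l (\<lambda>l'. \<Sum>i\<in>A. w i l') = (\<Sum>i\<in>A. koszul_d z l (w i))"
  by (induction A rule: infinite_finite_induct) (auto simp: koszul_d_add)

lemma koszul_d_add_coeff: "koszul_d (\<lambda>i. z i + z' i) l w = koszul_d z l w + koszul_d z' l w"
  by (induction l arbitrary: w) (auto simp: algebra_simps)

lemma koszul_d_mult_coeff: "koszul_d (\<lambda>i. c * z i) l w = c * koszul_d z l w"
  by (induction l arbitrary: w) (auto simp: algebra_simps)

text \<open>Peeling off the head index twice, the two copies of \<open>z i * koszul_d z l w\<close>
  cancel and the same expression for the contracted cochain \<open>\<lambda>l'. w (i # l')\<close>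
  remains; hence the induction generalizes over \<open>w\<close>.\<close>

lemma koszul_d_koszul_d: "koszul_d z l (\<lambda>l'. koszul_d z l' w) = 0"
  by (induction l arbitrary: w) (auto simp: koszul_d_diff koszul_d_mult)

lemma koszul_d_anticommute: "koszul_d z l (\<lambda>l'. koszul_d z' l' w) = - koszul_d z' l (\<lambda>l'. koszul_d z l' w)"
  by (induction l arbitrary: w) (auto simp: koszul_d_diff koszul_d_mult)

lemma koszul_d_length:
  assumes "\<And>l. length l \<noteq> n \<Longrightarrow> w l = 0" "length l \<noteq> Suc n"
  shows "koszul_d z l w = 0"
  using assms
proof (induction l arbitrary: w n)
  case (Cons i l)
  show ?case
  proof (cases n)
    case 0
    then have "(\<lambda>l'. w (i # l')) = (\<lambda>_. 0)" using Cons.prems(1) by auto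
    then show ?thesis using Cons.prems 0 by simp
  next
    case (Suc n')
    have "koszul_d z l (\<lambda>l'. w (i # l')) = 0"
      by (rule Cons.IH[of n']) (use Cons.prems Suc in auto)
    then show ?thesis using Cons.prems by simp
  qed
qed auto

definition unit_coeff :: "nat \<Rightarrow> nat \<Rightarrow> 'a::comm_ring_1" where
  "unit_coeff t i = (if i = t then 1 else 0)"

text \<open>The exterior product of the basis covectors listed in \<open>ts\<close>, as a cochain:
  \<open>koszul_d z\<close> is left multiplication by the covector with coefficients
  \<open>z\<close>, so unit coefficients adjoin one basis covector.\<close>

primrec wedge :: "nat list \<Rightarrow> nat list \<Rightarrow> 'a::comm_ring_1" where
  "wedge [] = (\<lambda>l. if l = [] then 1 else 0)"
| "wedge (t # ts) = (\<lambda>l. koszul_d (unit_coeff t) l (wedge ts))"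

lemma wedge_length: "length l \<noteq> length ts \<Longrightarrow> wedge ts l = 0"
  by (induction ts arbitrary: l) (auto intro: koszul_d_length)

lemma wedge_Cons_notin: "i \<notin> set ts \<Longrightarrow> wedge ts (i # l) = 0"
  by (induction ts arbitrary: l) (auto simp: unit_coeff_def)

lemma wedge_self: "distinct ts \<Longrightarrow> wedge ts ts = 1"
  by (induction ts) (auto simp: unit_coeff_def wedge_Cons_notin)

lemma koszul_d_unit_wedge: "t \<in> set ts \<Longrightarrow> koszul_d (unit_coeff t) l (wedge ts) = 0"
proof (induction ts arbitrary: l)
  case (Cons t' ts)
  show ?case
  proof (cases "t = t'")
    case True
    then show ?thesis by (simp add: koszul_d_koszul_d)
  next
    case False
    then show ?thesis using Cons by (simp add: koszul_d_anticommute[of "unit_coeff t"])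
  qed
qed auto

text \<open>Covectors already present in the product contribute nothing, so their coefficients may
  be set to zero one index at a time. The induction runs over \<open>ts'\<close> while the product
  over \<open>ts\<close> stays fixed.\<close>

lemma koszul_d_wedge_restrict:
  "set ts' \<subseteq> set ts \<Longrightarrow> koszul_d (\<lambda>i. if i \<in> set ts' then 0 else z i) l (wedge ts) = koszul_d z l (wedge ts)"
proof (induction ts')
  case (Cons t ts')
  let ?z = "\<lambda>ts' i. if i \<in> set ts' then 0 else z i"
  have eq: "?z ts' = (\<lambda>i. ?z (t # ts') i + ?z ts' t * unit_coeff t i)"
    by (auto simp: unit_coeff_def fun_eq_iff)
  have "koszul_d (?z ts') l (wedge ts) = koszul_d (?z (t # ts')) l (wedge ts) + ?z ts' t * koszul_d (unit_coeff t) l (wedge ts)"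
    using arg_cong[OF eq, of "\<lambda>z. koszul_d z l (wedge ts)"] by (simp only: koszul_d_add_coeff koszul_d_mult_coeff)
  moreover have "koszul_d (unit_coeff t) l (wedge ts) = (0::'a)"
    using Cons.prems by (intro koszul_d_unit_wedge) auto
  ultimately show ?case using Cons by simp
qed auto

section \<open>Ideals of the polynomial ring\<close>

lemma polyring_0 [simp]: "0 \<in> polyring N"
  by (simp add: polyring_def)

lemma polyring_1 [simp]: "1 \<in> polyring N"
  by (simp add: polyring_def)

lemma polyring_add [simp]: "p \<in> polyring N \<Longrightarrow> q \<in> polyring N \<Longrightarrow> p + q \<in> polyring N"
  using keys_add[of p q] by (auto simp: polyring_def)

lemma polyring_uminus [simp]: "p \<in> polyring N \<Longrightarrow> - p \<in> polyring N"
  by (simp add: polyring_def in_keys_iff)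

lemma polyring_diff [simp]: "p \<in> polyring N \<Longrightarrow> q \<in> polyring N \<Longrightarrow> p - q \<in> polyring N"
  using polyring_add[of p N "- q"] by simp

lemma polyring_mult [simp]:
  assumes "p \<in> polyring N" "q \<in> polyring N"
  shows "p * q \<in> polyring N"
proof -
  have "Poly_Mapping.keys (a + b) \<subseteq> {..<N}"
    if "a \<in> Poly_Mapping.keys p" "b \<in> Poly_Mapping.keys q" for a b
    using that assms keys_add[of a b] unfolding polyring_def by blast
  then show ?thesis
    using keys_mult[of p q] unfolding polyring_def by blast
qed

lemma polyring_sum [simp]: "(\<And>i. i \<in> A \<Longrightarrow> p i \<in> polyring N) \<Longrightarrow> (\<Sum>i\<in>A. p i) \<in> polyring N"
  by (induction A rule: infinite_finite_induct) auto

lemma polyring_var [simp]: "i < N \<Longrightarrow> var i \<in> polyring N"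
  by (simp add: polyring_def var_def)

lemma is_idealD:
  assumes "is_ideal N I"
  shows "I \<subseteq> polyring N" "0 \<in> I"
    "x \<in> I \<Longrightarrow> y \<in> I \<Longrightarrow> x + y \<in> I"
    "r \<in> polyring N \<Longrightarrow> x \<in> I \<Longrightarrow> r * x \<in> I"
  using assms by (auto simp: is_ideal_def)

lemma is_ideal_polyring [simp]: "is_ideal N (polyring N)"
  by (simp add: is_ideal_def)

lemma is_ideal_uminus: "is_ideal N I \<Longrightarrow> x \<in> I \<Longrightarrow> - x \<in> I"
  using is_idealD(4)[of N I "- 1" x] by simp

lemma is_ideal_diff: "is_ideal N I \<Longrightarrow> x \<in> I \<Longrightarrow> y \<in> I \<Longrightarrow> x - y \<in> I"
  using is_idealD(3)[of N I x "- y"] is_ideal_uminus[of N I y] by simp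

lemma is_ideal_sum: "is_ideal N I \<Longrightarrow> (\<And>i. i \<in> A \<Longrightarrow> x i \<in> I) \<Longrightarrow> (\<Sum>i\<in>A. x i) \<in> I"
  by (induction A rule: infinite_finite_induct) (auto intro: is_idealD)

lemma is_ideal_ideal_gen [simp]: "S \<subseteq> polyring N \<Longrightarrow> is_ideal N (ideal_gen N S)"
  unfolding ideal_gen_def is_ideal_def by auto

lemma ideal_gen_superset: "S \<subseteq> ideal_gen N S"
  by (auto simp: ideal_gen_def)

lemma ideal_gen_least: "is_ideal N I \<Longrightarrow> S \<subseteq> I \<Longrightarrow> ideal_gen N S \<subseteq> I"
  by (auto simp: ideal_gen_def)

lemma ideal_gen_ideal [simp]: "is_ideal N I \<Longrightarrow> ideal_gen N I = I"
  using ideal_gen_superset ideal_gen_least by blast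

lemma ideal_gen_insertE:
  fixes f :: "'k::field mpoly"
  assumes "S \<subseteq> polyring N" "f \<in> polyring N" "x \<in> ideal_gen N (insert f S)"
  obtains y r where "y \<in> ideal_gen N S" "r \<in> polyring N" "x = y + r * f"
proof -
  let ?I = "ideal_gen N S"
  let ?K = "{y + r * f | y r. y \<in> ?I \<and> r \<in> polyring N}"
  have I: "is_ideal N ?I" using assms by simp
  have "is_ideal N ?K"
    unfolding is_ideal_def
  proof (intro conjI ballI)
    show "?K \<subseteq> polyring N"
      using is_idealD(1)[OF I] assms(2) by (auto intro!: polyring_add polyring_mult)
    have "0 = 0 + 0 * f" by simp
    then show "0 \<in> ?K" using is_idealD(2)[OF I] polyring_0 by blast
  next
    fix a b assume "a \<in> ?K" "b \<in> ?K"
    then obtain y r y' r' where *: "y \<in> ?I" "r \<in> polyring N" "a = y + r * f"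
        "y' \<in> ?I" "r' \<in> polyring N" "b = y' + r' * f" by blast
    then have "a + b = (y + y') + (r + r') * f" by (simp add: algebra_simps)
    then show "a + b \<in> ?K" using * is_idealD(3)[OF I] polyring_add by blast
  next
    fix c a :: "'k mpoly" assume "c \<in> polyring N" "a \<in> ?K"
    then obtain y r where *: "y \<in> ?I" "r \<in> polyring N" "a = y + r * f" by blast
    then have "c * a = c * y + (c * r) * f" by (simp add: algebra_simps)
    then show "c * a \<in> ?K" using * \<open>c \<in> polyring N\<close> is_idealD(4)[OF I] polyring_mult by blast
  qed
  moreover have "insert f S \<subseteq> ?K"
  proof -
    have "f = 0 + 1 * f" by simp
    then have "f \<in> ?K" using is_idealD(2)[OF I] polyring_1 by blast
    moreover have "s \<in> ?K" if "s \<in> S" for s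
    proof -
      have "s = s + 0 * f" by simp
      then show ?thesis using that ideal_gen_superset[of S N] polyring_0 by blast
    qed
    ultimately show ?thesis by blast
  qed
  ultimately have "ideal_gen N (insert f S) \<subseteq> ?K" by (rule ideal_gen_least)
  then show ?thesis using assms(3) that by blast
qed

section \<open>An upper bound for the length of regular sequences\<close>

lemma koszul_d_ideal:
  assumes "is_ideal N I" "\<And>i. i \<in> set l \<Longrightarrow> z i \<in> polyring N" "\<And>l. w l \<in> I"
  shows "koszul_d z l w \<in> I"
  using assms by (induction l arbitrary: w) (auto intro!: is_ideal_diff is_idealD)

lemma koszul_d_ideal_coeff:
  assumes "is_ideal N I" "\<And>i. i \<in> set l \<Longrightarrow> z i \<in> I" "\<And>l. w l \<in> polyring N"
  shows "koszul_d z l w \<in> I"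
  using assms
proof (induction l arbitrary: w)
  case (Cons i l)
  have "w l * z i \<in> I" using Cons.prems by (intro is_idealD(4)) auto
  then show ?case
    using Cons.IH[of "\<lambda>l'. w (i # l')"] Cons.prems by (auto simp: mult.commute intro!: is_ideal_diff)
qed (auto intro: is_idealD)

lemma wedge_polyring: "(wedge ts l :: 'k::field mpoly) \<in> polyring N"
proof (induction ts arbitrary: l)
  case (Cons t ts)
  have "koszul_d (unit_coeff t) l (wedge ts) \<in> (polyring N :: 'k mpoly set)"
    by (rule koszul_d_ideal[OF is_ideal_polyring]) (auto simp: Cons unit_coeff_def)
  then show ?case by simp
qed auto

text \<open>A connecting map in Koszul cohomology: multiplication by \<open>f\<close> is
  null-homotopic through contraction with \<open>g\<close>. So contracting a cocycle modulo
  \<open>J\<close> gives a cocycle modulo \<open>J'\<close> of degree one lower, and its class stays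
  nonzero because \<open>f\<close> is a nonzerodivisor modulo \<open>J\<close>.\<close>

lemma koszul_step:
  assumes J: "is_ideal N J" and J': "J' = ideal_gen N (insert f J)"
    and f: "f \<in> polyring N" "f = (\<Sum>i<N. g i * z i)"
    and g: "\<And>i. g i \<in> polyring N" and z: "\<And>i. z i \<in> polyring N"
    and colon: "ideal_colon N J f = J"
    and w: "\<And>l. w l \<in> polyring N"
    and cocycle: "\<And>l. koszul_d z l w \<in> J"
    and not_bd: "\<And>\<eta>. (\<And>l. \<eta> l \<in> polyring N) \<Longrightarrow> \<exists>l. w l - koszul_d z l \<eta> \<notin> J"
    and v_def: "v = (\<lambda>l. \<Sum>i<N. g i * w (i # l))"
  shows "koszul_d z l v \<in> J'"
    and "(\<And>l. \<eta> l \<in> polyring N) \<Longrightarrow> \<exists>l. v l - koszul_d z l \<eta> \<notin> J'"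
proof -
  have Jp: "J \<subseteq> polyring N" using is_idealD(1)[OF J] .
  have J'i: "is_ideal N J'" using J' Jp f by simp
  have JJ': "J \<subseteq> J'" "f \<in> J'" using J' ideal_gen_superset[of "insert f J" N] by auto
  \<comment> \<open>Cartan's formula: evaluating the differential of \<open>w\<close> on
    \<open>i # l\<close> and summing with weights \<open>g i\<close> collects the leading terms into
    \<open>f * w l\<close>, and the sum lies in \<open>J\<close> because \<open>w\<close> is a
    cocycle modulo \<open>J\<close>.\<close>
  have homotopy: "f * w l - koszul_d z l v \<in> J" for l
  proof -
    have "koszul_d z l v = (\<Sum>i<N. g i * koszul_d z l (\<lambda>l'. w (i # l')))"
      by (simp add: v_def koszul_d_sum koszul_d_mult)
    also have "\<dots> = (\<Sum>i<N. g i * z i * w l - g i * koszul_d z (i # l) w)"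
      by (simp add: algebra_simps)
    also have "\<dots> = f * w l - (\<Sum>i<N. g i * koszul_d z (i # l) w)"
      by (simp add: f(2) sum_subtractf sum_distrib_right)
    finally have "f * w l - koszul_d z l v = (\<Sum>i<N. g i * koszul_d z (i # l) w)" by simp
    moreover have "(\<Sum>i<N. g i * koszul_d z (i # l) w) \<in> J"
      using g cocycle by (intro is_ideal_sum[OF J] is_idealD(4)[OF J])
    ultimately show ?thesis by simp
  qed
  show "koszul_d z l v \<in> J'"
  proof -
    have "w l * f \<in> J'" using is_idealD(4)[OF J'i] w JJ' by blast
    moreover have "f * w l - koszul_d z l v \<in> J'" using homotopy JJ' by blast
    ultimately have "w l * f - (f * w l - koszul_d z l v) \<in> J'" by (rule is_ideal_diff[OF J'i])
    then show ?thesis by (simp add: mult.commute)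
  qed
  assume \<eta>: "\<And>l. \<eta> l \<in> polyring N"
  show "\<exists>l. v l - koszul_d z l \<eta> \<notin> J'"
  proof (rule ccontr)
    assume "\<not> ?thesis"
    then have in_J': "v l - koszul_d z l \<eta> \<in> ideal_gen N (insert f J)" for l
      by (simp add: J')
    have "\<exists>y r. y \<in> J \<and> r \<in> polyring N \<and> v l = koszul_d z l \<eta> + (y + r * f)" for l
    proof -
      obtain y r where "y \<in> ideal_gen N J" "r \<in> polyring N" "v l - koszul_d z l \<eta> = y + r * f"
        using ideal_gen_insertE[OF Jp f(1) in_J'] .
      then show ?thesis using J by (intro exI[of _ y] exI[of _ r]) (simp add: algebra_simps)
    qed
    then obtain y r where yr: "\<And>l. y l \<in> J" "\<And>l. r l \<in> polyring N"
      "\<And>l. v l = koszul_d z l \<eta> + (y l + r l * f)"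
      by metis
    \<comment> \<open>The differential of \<open>v\<close> is computed twice: from its presentation
      as a boundary plus \<open>y + f * r\<close>, and from the homotopy. Modulo \<open>J\<close>
      this equates \<open>f\<close> times the boundary of \<open>r\<close> with
      \<open>f * w\<close>, and \<open>f\<close> can be cancelled.\<close>
    have "w l - koszul_d z l r \<in> J" for l
    proof -
      have "v = (\<lambda>l. koszul_d z l \<eta> + (y l + f * r l))" using yr(3) by (auto simp: mult.commute)
      then have "koszul_d z l v = koszul_d z l y + f * koszul_d z l r"
        by (simp add: koszul_d_add koszul_d_koszul_d koszul_d_mult)
      moreover have "koszul_d z l y \<in> J" by (rule koszul_d_ideal[OF J]) (use z yr in auto)
      ultimately have "(f * w l - (koszul_d z l y + f * koszul_d z l r)) + koszul_d z l y \<in> J"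
        using homotopy[of l] is_idealD(3)[OF J] by metis
      then have "(w l - koszul_d z l r) * f \<in> J" by (simp add: algebra_simps)
      moreover have "koszul_d z l r \<in> polyring N"
        by (rule koszul_d_ideal[OF is_ideal_polyring]) (use z yr in auto)
      ultimately show ?thesis using colon w by (auto simp: ideal_colon_def)
    qed
    then show False using not_bd[of r] yr(2) by blast
  qed
qed

text \<open>Each member of the regular sequence turns a nonzero cohomology class into one of degree
  one lower, and below degree zero there is none.\<close>

lemma regular_seq_length_le_koszul:
  assumes I: "is_ideal N I" and reg: "regular_seq N I fs"
    and z: "\<And>i. z i \<in> polyring N"
    and m: "\<And>f. f \<in> max_hom_ideal N \<Longrightarrow> \<exists>g. (\<forall>i. g i \<in> polyring N) \<and> f = (\<Sum>i<N. g i * z i)"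
    and w: "\<And>l. w l \<in> polyring N" "\<And>l. length l \<noteq> d \<Longrightarrow> w l = 0"
      "\<And>l. koszul_d z l w \<in> I" "\<And>\<eta>. (\<And>l. \<eta> l \<in> polyring N) \<Longrightarrow> \<exists>l. w l - koszul_d z l \<eta> \<notin> I"
  shows "length fs \<le> d"
proof -
  define J where "J k = ideal_gen N (I \<union> set (take k fs))" for k
  have fm: "f \<in> max_hom_ideal N" if "f \<in> set fs" for f
    using reg that by (auto simp: regular_seq_def)
  have fp: "f \<in> polyring N" if f: "f \<in> set fs" for f
  proof -
    obtain g where "\<forall>i. g i \<in> polyring N" "f = (\<Sum>i<N. g i * z i)" using m[OF fm[OF f]] by blast
    then show ?thesis using z by auto
  qed
  have Ji: "is_ideal N (J k)" for k
    unfolding J_def using is_idealD(1)[OF I] fp set_take_subset[of k fs]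
    by (intro is_ideal_ideal_gen) blast
  \<comment> \<open>Degree \<open>d - k\<close> is encoded as \<open>length l + k = d\<close>, so
    that for \<open>k > d\<close> the cochain is forced to vanish instead of having its degree
    truncated at zero.\<close>
  have chain: "k \<le> length fs \<Longrightarrow> \<exists>w. (\<forall>l. w l \<in> polyring N) \<and> (\<forall>l. length l + k \<noteq> d \<longrightarrow> w l = 0) \<and>
      (\<forall>l. koszul_d z l w \<in> J k) \<and> (\<forall>\<eta>. (\<forall>l. \<eta> l \<in> polyring N) \<longrightarrow> (\<exists>l. w l - koszul_d z l \<eta> \<notin> J k))" for k
  proof (induction k)
    case 0
    then show ?case using w I by (intro exI[of _ w]) (auto simp: J_def)
  next
    case (Suc k)
    define f where "f = fs ! k"
    have f: "f \<in> set fs" using Suc.prems by (simp add: f_def)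
    obtain w where w: "\<And>l. w l \<in> polyring N" "\<And>l. length l + k \<noteq> d \<Longrightarrow> w l = 0"
      "\<And>l. koszul_d z l w \<in> J k" "\<And>\<eta>. (\<And>l. \<eta> l \<in> polyring N) \<Longrightarrow> \<exists>l. w l - koszul_d z l \<eta> \<notin> J k"
      using Suc by auto
    obtain g where g: "\<And>i. g i \<in> polyring N" "f = (\<Sum>i<N. g i * z i)" using m[OF fm[OF f]] by blast
    have colon: "ideal_colon N (J k) f = J k"
      using reg Suc.prems by (auto simp: regular_seq_def J_def f_def)
    have J': "J (Suc k) = ideal_gen N (insert f (J k))"
    proof (rule antisym)
      have "I \<union> set (take (Suc k) fs) \<subseteq> insert f (J k)"
        using ideal_gen_superset[of "I \<union> set (take k fs)" N] Suc.prems
        by (auto simp: J_def f_def take_Suc_conv_app_nth)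
      then show "J (Suc k) \<subseteq> ideal_gen N (insert f (J k))"
        unfolding J_def[of "Suc k"]
        using ideal_gen_superset[of "insert f (J k)" N] is_idealD(1)[OF Ji] fp[OF f]
        by (intro ideal_gen_least) auto
      have "f \<in> J (Suc k)"
        using ideal_gen_superset[of "I \<union> set (take (Suc k) fs)" N] Suc.prems
        by (auto simp: J_def f_def take_Suc_conv_app_nth)
      moreover have "I \<union> set (take k fs) \<subseteq> J (Suc k)"
        using ideal_gen_superset[of "I \<union> set (take (Suc k) fs)" N] Suc.prems
        by (auto simp: J_def take_Suc_conv_app_nth)
      then have "J k \<subseteq> J (Suc k)" unfolding J_def[of k] using Ji by (intro ideal_gen_least) auto
      ultimately show "ideal_gen N (insert f (J k)) \<subseteq> J (Suc k)"
        using Ji by (intro ideal_gen_least) auto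
    qed
    define v where "v = (\<lambda>l. \<Sum>i<N. g i * w (i # l))"
    note step = koszul_step[OF Ji J' fp[OF f] g(2) g(1) z colon w(1) w(3) w(4) v_def]
    have "v l = 0" if "length l + Suc k \<noteq> d" for l
      using that w(2) by (simp add: v_def)
    moreover have "v l \<in> polyring N" for l
      using w(1) g(1) by (simp add: v_def)
    ultimately show ?case
      using step by (intro exI[of _ v]) blast
  qed
  show ?thesis
  proof (rule ccontr)
    assume "\<not> length fs \<le> d"
    then obtain w where w: "\<forall>l. length l + Suc d \<noteq> d \<longrightarrow> w l = 0"
      "\<forall>\<eta>. (\<forall>l. \<eta> l \<in> polyring N) \<longrightarrow> (\<exists>l. w l - koszul_d z l \<eta> \<notin> J (Suc d))"
      using chain[of "Suc d"] by auto
    then have "w = (\<lambda>_. 0)" by auto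
    then obtain l where "w l - koszul_d z l (\<lambda>_. 0) \<notin> J (Suc d)"
      using w(2)[rule_format, of "\<lambda>_. 0"] by auto
    then show False using \<open>w = (\<lambda>_. 0)\<close> is_idealD(2)[OF Ji] by simp
  qed
qed


text \<open>The class used is \<open>u\<close> times the exterior product over \<open>ts\<close>. It
  is a cocycle modulo \<open>I\<close> because the coordinates in \<open>ts\<close> drop out of the
  differential and all others annihilate \<open>u\<close> modulo \<open>I\<close>.\<close>

lemma regular_seq_length_le:
  assumes I: "is_ideal N I" and reg: "regular_seq N I fs"
    and z: "\<And>i. z i \<in> polyring N"
    and m: "\<And>f. f \<in> max_hom_ideal N \<Longrightarrow> \<exists>g. (\<forall>i. g i \<in> polyring N) \<and> f = (\<Sum>i<N. g i * z i)"
    and ts: "distinct ts" and u: "u \<in> polyring N"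
    and killed: "\<And>i. i \<notin> set ts \<Longrightarrow> z i * u \<in> I"
    and u_notin: "u \<notin> ideal_gen N (I \<union> z ` set ts)"
  shows "length fs \<le> length ts"
proof (rule regular_seq_length_le_koszul[OF I reg z m, where w = "\<lambda>l. u * wedge ts l"])
  show "u * wedge ts l \<in> polyring N" for l
    by (rule polyring_mult[OF u wedge_polyring])
  show "u * wedge ts l = 0" if "length l \<noteq> length ts" for l
    using that by (simp add: wedge_length)
  show "koszul_d z l (\<lambda>l. u * wedge ts l) \<in> I" for l
  proof -
    have "koszul_d z l (\<lambda>l. u * wedge ts l) = u * koszul_d z l (wedge ts)"
      by (rule koszul_d_mult)
    also have "\<dots> = koszul_d (\<lambda>i. u * (if i \<in> set ts then 0 else z i)) l (wedge ts)"
      by (simp only: koszul_d_mult_coeff koszul_d_wedge_restrict[OF order_refl])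
    also have "\<dots> \<in> I"
      using killed is_idealD(2)[OF I]
      by (intro koszul_d_ideal_coeff[OF I]) (auto simp: mult.commute wedge_polyring)
    finally show ?thesis .
  qed
  let ?I = "ideal_gen N (I \<union> z ` set ts)"
  have J: "is_ideal N ?I"
    using is_idealD(1)[OF I] z by (intro is_ideal_ideal_gen) auto
  show "\<exists>l. u * wedge ts l - koszul_d z l \<eta> \<notin> I" if "\<And>l. \<eta> l \<in> polyring N" for \<eta>
  proof (intro exI notI)
    \<comment> \<open>The value at the list \<open>ts\<close> itself decides: the product is
      \<open>1\<close> there, while every boundary takes a value in the ideal
      \<open>?I\<close>.\<close>
    assume "u * wedge ts ts - koszul_d z ts \<eta> \<in> I"
    then have "u - koszul_d z ts \<eta> \<in> ?I"
      using ideal_gen_superset[of "I \<union> z ` set ts" N] by (auto simp: wedge_self[OF ts])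
    moreover have "koszul_d z ts \<eta> \<in> ?I"
      using ideal_gen_superset[of "I \<union> z ` set ts" N] that by (intro koszul_d_ideal_coeff[OF J]) auto
    ultimately have "u - koszul_d z ts \<eta> + koszul_d z ts \<eta> \<in> ?I" by (rule is_idealD(3)[OF J])
    then show False using u_notin by simp
  qed
qed

section \<open>Monomial ideals\<close>

definition exps :: "nat \<Rightarrow> (nat \<Rightarrow>\<^sub>0 nat) set" where
  "exps N = {w. Poly_Mapping.keys w \<subseteq> {..<N}}"

text \<open>Monomial ideals are handled through their exponent sets: together with
  \<open>exp_ideal\<close>, membership becomes a condition on each exponent separately.\<close>

definition mon_span :: "(nat \<Rightarrow>\<^sub>0 nat) set \<Rightarrow> 'k::field mpoly set" where
  "mon_span U = {p. Poly_Mapping.keys p \<subseteq> U}"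

definition exp_ideal :: "nat \<Rightarrow> (nat \<Rightarrow>\<^sub>0 nat) set \<Rightarrow> bool" where
  "exp_ideal N U \<longleftrightarrow> U \<subseteq> exps N \<and> (\<forall>w\<in>U. \<forall>v\<in>exps N. w + v \<in> U)"

lemma polyring_eq_mon_span: "polyring N = mon_span (exps N)"
  by (auto simp: polyring_def mon_span_def exps_def)

lemma exps_add [simp]: "v \<in> exps N \<Longrightarrow> w \<in> exps N \<Longrightarrow> v + w \<in> exps N"
  using keys_add[of v w] by (auto simp: exps_def)

lemma exps_keysD: "w \<in> exps N \<Longrightarrow> i \<in> Poly_Mapping.keys w \<Longrightarrow> i < N"
  by (auto simp: exps_def)

lemma exps_0 [simp]: "0 \<in> exps N"
  by (simp add: exps_def)

lemma exps_single [simp]: "i < N \<Longrightarrow> Poly_Mapping.single i n \<in> exps N"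
  by (simp add: exps_def)

lemma monom_add: "monom (v + w) = monom v * monom w"
  by (simp add: monom_def mult_single)

lemma monom_in_mon_span [simp]: "(monom w :: 'k::field mpoly) \<in> mon_span U \<longleftrightarrow> w \<in> U"
  by (simp add: monom_def mon_span_def)

lemma poly_mapping_expand:
  fixes p :: "'a \<Rightarrow>\<^sub>0 'b::comm_monoid_add"
  shows "p = (\<Sum>w\<in>Poly_Mapping.keys p. Poly_Mapping.single w (Poly_Mapping.lookup p w))"
proof (rule poly_mapping_eqI)
  fix v
  have "(\<Sum>w\<in>Poly_Mapping.keys p. Poly_Mapping.lookup (Poly_Mapping.single w (Poly_Mapping.lookup p w)) v)
      = (\<Sum>w\<in>Poly_Mapping.keys p. if w = v then Poly_Mapping.lookup p v else 0)"
    by (intro sum.cong) (auto simp: lookup_single when_def)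
  then show "Poly_Mapping.lookup p v = Poly_Mapping.lookup
      (\<Sum>w\<in>Poly_Mapping.keys p. Poly_Mapping.single w (Poly_Mapping.lookup p w)) v"
    by (simp add: lookup_sum sum.delta in_keys_iff)
qed

lemma poly_expand:
  fixes p :: "'k::field mpoly"
  shows "p = (\<Sum>w\<in>Poly_Mapping.keys p. Poly_Mapping.single 0 (Poly_Mapping.lookup p w) * monom w)"
  by (simp add: monom_def mult_single flip: poly_mapping_expand)

lemma polyring_const [simp]: "Poly_Mapping.single 0 c \<in> polyring N"
  by (simp add: polyring_def)

lemma mon_span_is_ideal:
  assumes "exp_ideal N U"
  shows "is_ideal N (mon_span U :: 'k::field mpoly set)"
  unfolding is_ideal_def
proof (intro conjI ballI)
  show "mon_span U \<subseteq> (polyring N :: 'k mpoly set)"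
    using assms by (auto simp: polyring_eq_mon_span mon_span_def exp_ideal_def)
  show "0 \<in> (mon_span U :: 'k mpoly set)" by (simp add: mon_span_def)
next
  fix x y :: "'k mpoly" assume "x \<in> mon_span U" "y \<in> mon_span U"
  then show "x + y \<in> mon_span U" using keys_add[of x y] unfolding mon_span_def by blast
next
  fix r x :: "'k mpoly" assume "r \<in> polyring N" "x \<in> mon_span U"
  then show "r * x \<in> mon_span U"
    using keys_mult[of x r] assms
    unfolding polyring_eq_mon_span mon_span_def exp_ideal_def by (fastforce simp: mult.commute)
qed

lemma mon_span_subset_ideal:
  fixes I :: "'k::field mpoly set"
  assumes "is_ideal N I" "\<And>w. w \<in> U \<Longrightarrow> monom w \<in> I"
  shows "mon_span U \<subseteq> I"
proof
  fix p :: "'k mpoly" assume "p \<in> mon_span U"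
  then have "(\<Sum>w\<in>Poly_Mapping.keys p. Poly_Mapping.single 0 (Poly_Mapping.lookup p w) * monom w) \<in> I"
    using assms by (intro is_ideal_sum[OF assms(1)] is_idealD(4)[OF assms(1)]) (auto simp: mon_span_def)
  then show "p \<in> I" by (simp flip: poly_expand)
qed

lemma mon_span_eq_ideal_gen:
  assumes "exp_ideal N U"
  shows "(mon_span U :: 'k::field mpoly set) = ideal_gen N (monom ` U)"
proof (rule antisym)
  have "monom ` U \<subseteq> (polyring N :: 'k mpoly set)"
    using assms by (auto simp: polyring_eq_mon_span exp_ideal_def)
  then show "mon_span U \<subseteq> (ideal_gen N (monom ` U) :: 'k mpoly set)"
    using ideal_gen_superset[of "monom ` U :: 'k mpoly set" N]
    by (intro mon_span_subset_ideal[OF is_ideal_ideal_gen]) auto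
  show "(ideal_gen N (monom ` U) :: 'k mpoly set) \<subseteq> mon_span U"
  proof (rule ideal_gen_least)
    show "is_ideal N (mon_span U :: 'k mpoly set)" using assms by (rule mon_span_is_ideal)
  qed auto
qed

text \<open>Keys of a product are sums of keys, and a monomial with exponent \<open>v + w\<close>
  factors; so powers can be formed on exponent sets alone.\<close>

lemma ideal_pow_mon_span:
  fixes U :: "nat \<Rightarrow> (nat \<Rightarrow>\<^sub>0 nat) set"
  assumes "\<And>n. exp_ideal N (U n)" "U 0 = exps N"
    and "\<And>n. U (Suc n) = {v + w | v w. v \<in> U n \<and> w \<in> U 1}"
  shows "ideal_pow N (mon_span (U 1) :: 'k::field mpoly set) n = mon_span (U n)"
proof (induction n)
  case 0
  show ?case by (simp add: polyring_eq_mon_span assms(2))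
next
  case (Suc n)
  let ?S = "{a * b | a b :: 'k mpoly. a \<in> mon_span (U n) \<and> b \<in> mon_span (U 1)}"
  have I: "is_ideal N (mon_span (U n) :: 'k mpoly set)" for n
    using assms(1) by (rule mon_span_is_ideal)
  have "?S \<subseteq> mon_span (U (Suc n))"
  proof
    fix p assume "p \<in> ?S"
    then obtain a b where "p = a * b" "a \<in> mon_span (U n)" "b \<in> mon_span (U 1)" by blast
    then show "p \<in> mon_span (U (Suc n))"
      using keys_mult[of a b] unfolding mon_span_def assms(3)[of n] by blast
  qed
  then have "ideal_gen N ?S \<subseteq> mon_span (U (Suc n))"
    using I by (intro ideal_gen_least)
  moreover have "mon_span (U (Suc n)) \<subseteq> ideal_gen N ?S"
  proof (rule mon_span_subset_ideal)
    have "?S \<subseteq> polyring N" using is_idealD(1)[OF I] by (blast intro: polyring_mult)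
    then show "is_ideal N (ideal_gen N ?S)" by simp
    fix u assume "u \<in> U (Suc n)"
    then obtain v w where u: "u = v + w" "v \<in> U n" "w \<in> U 1" unfolding assms(3)[of n] by blast
    have "monom v * monom w \<in> ?S" using u(2,3) monom_in_mon_span by blast
    then show "monom u \<in> ideal_gen N ?S"
      unfolding u(1) monom_add by (rule subsetD[OF ideal_gen_superset])
  qed
  ultimately show ?case using Suc by simp
qed

section \<open>Identifying variables\<close>

text \<open>Used on two levels: along maps of variables it acts on exponent vectors, and along maps
  of exponent vectors it acts on polynomials, where it is multiplicative if the map is
  additive.\<close>

definition push :: "('a \<Rightarrow> 'c) \<Rightarrow> ('a \<Rightarrow>\<^sub>0 'b::comm_monoid_add) \<Rightarrow> 'c \<Rightarrow>\<^sub>0 'b" where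
  "push g p = (\<Sum>w\<in>Poly_Mapping.keys p. Poly_Mapping.single (g w) (Poly_Mapping.lookup p w))"

lemma push_superset:
  assumes "finite S" "Poly_Mapping.keys p \<subseteq> S"
  shows "push g p = (\<Sum>w\<in>S. Poly_Mapping.single (g w) (Poly_Mapping.lookup p w))"
  unfolding push_def using assms by (intro sum.mono_neutral_left) (auto simp: in_keys_iff)

lemma push_add: "push g (p + q) = push g p + push g q"
proof -
  let ?S = "Poly_Mapping.keys p \<union> Poly_Mapping.keys q"
  have "push g (p + q) = (\<Sum>w\<in>?S. Poly_Mapping.single (g w) (Poly_Mapping.lookup (p + q) w))"
    by (rule push_superset) (use keys_add[of p q] in auto)
  also have "\<dots> = push g p + push g q"
    by (simp add: push_superset[of ?S] lookup_add single_add sum.distrib)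
  finally show ?thesis .
qed

lemma push_0 [simp]: "push g 0 = 0"
  by (simp add: push_def)

lemma push_single [simp]: "push g (Poly_Mapping.single w c) = Poly_Mapping.single (g w) c"
  by (simp add: push_def)

lemma push_sum: "push g (\<Sum>i\<in>A. p i) = (\<Sum>i\<in>A. push g (p i))"
  by (induction A rule: infinite_finite_induct) (auto simp: push_add)

lemma push_diff:
  fixes p q :: "'a \<Rightarrow>\<^sub>0 'b::ab_group_add"
  shows "push g (p - q) = push g p - push g q"
  using push_add[of g "p - q" q] by (simp add: algebra_simps)

lemma push_mult:
  fixes p q :: "'a::comm_monoid_add \<Rightarrow>\<^sub>0 'b::comm_semiring_0"
  assumes g: "\<And>v w. g (v + w) = g v + (g w :: 'c::comm_monoid_add)"
  shows "push g (p * q) = push g p * push g q"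
proof -
  let ?e = "\<lambda>p. \<Sum>v\<in>Poly_Mapping.keys p. Poly_Mapping.single v (Poly_Mapping.lookup p v)"
  have e: "?e p = p" "?e q = q" by (rule poly_mapping_expand[symmetric])+
  have "push g (?e p * ?e q) = (\<Sum>v\<in>Poly_Mapping.keys p. \<Sum>w\<in>Poly_Mapping.keys q.
      Poly_Mapping.single (g v) (Poly_Mapping.lookup p v) * Poly_Mapping.single (g w) (Poly_Mapping.lookup q w))"
    by (simp only: sum_product push_sum mult_single push_single g)
  also have "\<dots> = push g p * push g q"
    by (simp only: push_def sum_product)
  finally show ?thesis unfolding e .
qed

lemma keys_push: "Poly_Mapping.keys (push g p) \<subseteq> g ` Poly_Mapping.keys p"
proof
  fix v assume v: "v \<in> Poly_Mapping.keys (push g p)"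
  show "v \<in> g ` Poly_Mapping.keys p"
  proof (rule ccontr)
    assume "v \<notin> g ` Poly_Mapping.keys p"
    then have "Poly_Mapping.lookup (push g p) v = 0"
      unfolding push_def lookup_sum by (intro sum.neutral) (auto simp: lookup_single when_def)
    then show False using v by (simp add: in_keys_iff)
  qed
qed

lemma lookup_push: "Poly_Mapping.lookup (push g p) v =
    (\<Sum>w\<in>{w \<in> Poly_Mapping.keys p. g w = v}. Poly_Mapping.lookup p w)"
  unfolding push_def lookup_sum lookup_single when_def
  by (simp add: sum.inter_filter)

text \<open>The substitution of variable \<open>0\<close> for every variable in \<open>P\<close>,
  read on exponents.\<close>

definition merge :: "nat set \<Rightarrow> (nat \<Rightarrow>\<^sub>0 nat) \<Rightarrow> (nat \<Rightarrow>\<^sub>0 nat)" where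
  "merge P = push (\<lambda>i. if i \<in> P then 0 else i)"

lemma merge_add: "merge P (v + w) = merge P v + merge P w"
  by (simp add: merge_def push_add)

lemma merge_0 [simp]: "merge P 0 = 0"
  by (simp add: merge_def)

lemma merge_single [simp]:
  "merge P (Poly_Mapping.single i n) = Poly_Mapping.single (if i \<in> P then 0 else i) n"
  by (simp add: merge_def)

lemma lookup_merge:
  assumes "0 \<notin> P" "finite P"
  shows "Poly_Mapping.lookup (merge P w) i =
    (if i = 0 then Poly_Mapping.lookup w 0 + (\<Sum>j\<in>P. Poly_Mapping.lookup w j)
     else if i \<in> P then 0 else Poly_Mapping.lookup w i)"
proof -
  let ?K = "{j \<in> Poly_Mapping.keys w. (if j \<in> P then 0 else j) = i}"
  have eq: "Poly_Mapping.lookup (merge P w) i = (\<Sum>j\<in>?K. Poly_Mapping.lookup w j)"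
    by (simp add: merge_def lookup_push)
  show ?thesis
  proof (cases "i = 0")
    case True
    have "(\<Sum>j\<in>?K. Poly_Mapping.lookup w j) = (\<Sum>j\<in>insert 0 P. Poly_Mapping.lookup w j)"
      using assms True by (intro sum.mono_neutral_left) (auto simp: in_keys_iff split: if_splits)
    then show ?thesis using eq True assms by simp
  next
    case False
    have "(\<Sum>j\<in>?K. Poly_Mapping.lookup w j) = (\<Sum>j\<in>{i} - P. Poly_Mapping.lookup w j)"
      using False by (intro sum.mono_neutral_left) (auto simp: in_keys_iff split: if_splits)
    moreover have "{i} - P = (if i \<in> P then {} else {i})" by auto
    ultimately show ?thesis using eq False by simp
  qed
qed

lemma merge_exps:
  assumes "w \<in> exps N" "0 < N"
  shows "merge P w \<in> exps N"
proof -
  have "(\<lambda>i. if i \<in> P then 0 else i) ` Poly_Mapping.keys w \<subseteq> {..<N}"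
    using assms by (auto simp: exps_def)
  then show ?thesis
    using keys_push[of "\<lambda>i. if i \<in> P then 0 else i" w] unfolding exps_def merge_def by blast
qed

text \<open>The exponents with this property form a submonoid, since products of congruent monomials
  are congruent, and it contains the unit vectors.\<close>

lemma monom_diff_merge:
  assumes I: "is_ideal N I" and P: "\<And>i. i \<in> P \<Longrightarrow> var i - var 0 \<in> I" and N: "0 < N"
    and w: "w \<in> exps N"
  shows "monom w - monom (merge P w) \<in> I"
proof -
  let ?G = "{w \<in> exps N. monom w - monom (merge P w) \<in> I}"
  have add: "v + w \<in> ?G" if "v \<in> ?G" "w \<in> ?G" for v w
  proof -
    have "monom (v + w) - monom (merge P (v + w)) =
        monom v * (monom w - monom (merge P w)) + monom (merge P w) * (monom v - monom (merge P v) :: 'a mpoly)"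
      by (simp add: monom_add merge_add algebra_simps)
    also have "\<dots> \<in> I"
      using that merge_exps[OF _ N]
      by (intro is_idealD(3)[OF I] is_idealD(4)[OF I]) (auto simp: polyring_eq_mon_span)
    finally show ?thesis using that by auto
  qed
  have zero: "0 \<in> ?G" using is_idealD(2)[OF I] by simp
  have "Poly_Mapping.single i n \<in> ?G" if "i < N" for i n
  proof (induction n)
    case (Suc n)
    have "Poly_Mapping.single i (Suc 0) \<in> ?G"
      using that P[of i] is_idealD(2)[OF I] by (auto simp: monom_def var_def)
    from add[OF Suc this] show ?case by (simp add: single_add[symmetric])
  qed (use zero in simp)
  then have single: "Poly_Mapping.single i (Poly_Mapping.lookup w i) \<in> ?G"
    if "i \<in> Poly_Mapping.keys w" for i using w that by (blast dest: exps_keysD)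
  have sum: "(\<Sum>i\<in>A. Poly_Mapping.single i (Poly_Mapping.lookup w i)) \<in> ?G"
    if "\<And>i. i \<in> A \<Longrightarrow> Poly_Mapping.single i (Poly_Mapping.lookup w i) \<in> ?G" for A
    using that zero
  proof (induction A rule: infinite_finite_induct)
    case (insert x F)
    then have "Poly_Mapping.single x (Poly_Mapping.lookup w x)
        + (\<Sum>i\<in>F. Poly_Mapping.single i (Poly_Mapping.lookup w i)) \<in> ?G"
      by (intro add) auto
    then show ?case using insert by simp
  qed auto
  have "(\<Sum>i\<in>Poly_Mapping.keys w. Poly_Mapping.single i (Poly_Mapping.lookup w i)) \<in> ?G"
    by (rule sum) (rule single)
  then show ?thesis by (simp only: poly_mapping_expand[symmetric] mem_Collect_eq)
qed

text \<open>Dividing by the differences \<open>var i - var 0\<close> amounts to the substitution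
  \<open>merge P\<close>, so membership can be tested after substituting, again one exponent at a
  time.\<close>

lemma ideal_gen_binomials:
  fixes U :: "(nat \<Rightarrow>\<^sub>0 nat) set"
  assumes U: "exp_ideal N U" and P: "P \<subseteq> {..<N}" and N: "0 < N"
  shows "ideal_gen N (mon_span U \<union> (\<lambda>i. var i - var 0 :: 'k::field mpoly) ` P) =
    {p \<in> polyring N. push (merge P) p \<in> mon_span (merge P ` U)}" (is "?L = ?R")
proof (rule antisym)
  have U': "U \<subseteq> exps N" using U by (simp add: exp_ideal_def)
  have gens: "mon_span U \<union> (\<lambda>i. var i - var 0 :: 'k mpoly) ` P \<subseteq> polyring N"
    using P N is_idealD(1)[OF mon_span_is_ideal[OF U]] by (auto intro!: polyring_diff)
  then have L: "is_ideal N ?L" by simp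
  note LS = ideal_gen_superset[of "mon_span U \<union> (\<lambda>i. var i - var 0 :: 'k mpoly) ` P" N]
  show "?L \<subseteq> ?R"
  proof (rule ideal_gen_least)
    show "is_ideal N ?R"
      unfolding is_ideal_def
    proof (intro conjI ballI)
      show "?R \<subseteq> polyring N" by blast
      show "0 \<in> ?R" by (simp add: mon_span_def)
    next
      fix x y assume "x \<in> ?R" "y \<in> ?R"
      then show "x + y \<in> ?R"
        using keys_add[of "push (merge P) x" "push (merge P) y"]
        by (auto simp: push_add mon_span_def)
    next
      fix r x :: "'k mpoly" assume r: "r \<in> polyring N" and x: "x \<in> ?R"
      have "Poly_Mapping.keys (push (merge P) (r * x)) \<subseteq> merge P ` U"
      proof
        fix w assume "w \<in> Poly_Mapping.keys (push (merge P) (r * x))"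
        then have "w \<in> Poly_Mapping.keys (push (merge P) r * push (merge P) x)"
          by (simp add: push_mult merge_add)
        then obtain a b where w: "w = a + b" "a \<in> Poly_Mapping.keys (push (merge P) r)"
          "b \<in> Poly_Mapping.keys (push (merge P) x)" using keys_mult by blast
        obtain a' where a': "a = merge P a'" "a' \<in> exps N"
          using w(2) keys_push[of "merge P" r] r by (auto simp: polyring_def exps_def)
        obtain b' where b': "b = merge P b'" "b' \<in> U"
          using w(3) x by (auto simp: mon_span_def)
        have "w = merge P (b' + a')" using w a' b' by (simp add: merge_add add.commute)
        moreover have "b' + a' \<in> U" using U a' b' by (simp add: exp_ideal_def)
        ultimately show "w \<in> merge P ` U" by blast
      qed
      then show "r * x \<in> ?R" using r x by (simp add: mon_span_def)
    qed
    show "mon_span U \<union> (\<lambda>i. var i - var 0) ` P \<subseteq> ?R"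
    proof -
      have "push (merge P) p \<in> mon_span (merge P ` U)" if "p \<in> mon_span U" for p :: "'k mpoly"
        using that keys_push[of "merge P" p] unfolding mon_span_def by blast
      moreover have "push (merge P) (var i - var 0 :: 'k mpoly) \<in> mon_span (merge P ` U)" if "i \<in> P" for i
        using that by (simp add: push_diff var_def mon_span_def)
      ultimately show ?thesis using gens by blast
    qed
  qed
  show "?R \<subseteq> ?L"
  proof
    fix p assume p: "p \<in> ?R"
    have diff: "monom w - monom (merge P w) \<in> ?L" if "w \<in> exps N" for w
      by (rule monom_diff_merge[OF L _ N that]) (use LS in auto)
    have "monom (merge P w) \<in> ?L" if "w \<in> U" for w
    proof -
      have "monom w \<in> ?L" using that LS by auto
      then have "monom w - (monom w - monom (merge P w)) \<in> ?L"
        by (rule is_ideal_diff[OF L _ diff]) (use that U' in auto)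
      then show ?thesis by simp
    qed
    then have "mon_span (merge P ` U) \<subseteq> ?L" by (intro mon_span_subset_ideal[OF L]) auto
    then have "push (merge P) p \<in> ?L" using p by auto
    moreover have "p - push (merge P) p \<in> ?L"
    proof -
      have "p - push (merge P) p = (\<Sum>w\<in>Poly_Mapping.keys p.
          Poly_Mapping.single 0 (Poly_Mapping.lookup p w) * (monom w - monom (merge P w)))"
        by (simp add: push_def monom_def right_diff_distrib mult_single sum_subtractf
            flip: poly_mapping_expand)
      also have "\<dots> \<in> ?L"
        using p by (intro is_ideal_sum[OF L] is_idealD(4)[OF L] diff) (auto simp: polyring_def exps_def)
      finally show ?thesis .
    qed
    ultimately have "push (merge P) p + (p - push (merge P) p) \<in> ?L" by (rule is_idealD(3)[OF L])
    then show "p \<in> ?L" by simp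
  qed
qed

section \<open>Differences of variables as nonzerodivisors\<close>

lemma mult_monom: "p * monom t = push (\<lambda>w. w + t) p"
proof -
  have "p * monom t = (\<Sum>w\<in>Poly_Mapping.keys p. Poly_Mapping.single w (Poly_Mapping.lookup p w)) * monom t"
    using poly_mapping_expand[of p] by (rule arg_cong)
  also have "\<dots> = push (\<lambda>w. w + t) p"
    by (simp add: push_def sum_distrib_right monom_def mult_single)
  finally show ?thesis .
qed

lemma lookup_mult_monom: "Poly_Mapping.lookup (p * monom t) (w + t) = Poly_Mapping.lookup p w"
proof -
  have "{v \<in> Poly_Mapping.keys p. v + t = w + t} = (if w \<in> Poly_Mapping.keys p then {w} else {})"
    by auto
  then show ?thesis by (simp add: mult_monom lookup_push in_keys_iff)
qed

text \<open>Multiplying by a difference of two variables moves coefficients along the line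
  \<open>w + k (e\<^sub>j - e\<^sub>i)\<close>; a monomial of \<open>h\<close> outside \<open>W\<close> can only be cancelled by its neighbour,
  so following the line one must run into \<open>W\<close>.\<close>

lemma binomial_chain:
  fixes h :: "'k::field mpoly"
  assumes W: "\<And>w. w \<in> W \<Longrightarrow> w + Poly_Mapping.single i 1 \<in> W"
    and h: "Poly_Mapping.keys (h * (var j - var i)) \<subseteq> W" and "i \<noteq> j"
    and "w \<in> Poly_Mapping.keys h" "w \<notin> W"
  shows "\<exists>v k. v \<notin> W \<and> v + Poly_Mapping.single j 1 \<in> W \<and>
    v + Poly_Mapping.single i k = w + Poly_Mapping.single j k"
  using assms(4,5)
proof (induction "Poly_Mapping.lookup w i" arbitrary: w rule: less_induct)
  case less
  let ?i = "Poly_Mapping.single i (1::nat)" and ?j = "Poly_Mapping.single j (1::nat)"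
  show ?case
  proof (cases "w + ?j \<in> W")
    case True
    then show ?thesis using less.prems by (intro exI[of _ w] exI[of _ 0]) auto
  next
    case False
    then have "Poly_Mapping.lookup (h * (var j - var i)) (w + ?j) = 0"
      using h by (auto simp: in_keys_iff)
    then have "Poly_Mapping.lookup (h * monom ?i) (w + ?j) \<noteq> 0"
      using less.prems(1) lookup_mult_monom[of h ?j w]
      by (simp add: var_def monom_def right_diff_distrib lookup_minus in_keys_iff)
    then obtain w' where w': "w' \<in> Poly_Mapping.keys h" "w + ?j = w' + ?i"
      using keys_mult[of h "monom ?i"] by (auto simp: in_keys_iff monom_def split: if_splits)
    have "Poly_Mapping.lookup (w + ?j) i = Poly_Mapping.lookup (w' + ?i) i" using w'(2) by simp
    then have "Poly_Mapping.lookup w' i < Poly_Mapping.lookup w i"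
      using \<open>i \<noteq> j\<close> by (simp add: lookup_add lookup_single)
    moreover have "w' \<notin> W" using W[of w'] False w'(2) by auto
    ultimately obtain v k where v: "v \<notin> W" "v + ?j \<in> W"
      "v + Poly_Mapping.single i k = w' + Poly_Mapping.single j k"
      using less.hyps w'(1) by blast
    have "v + Poly_Mapping.single i (Suc k) = (v + Poly_Mapping.single i k) + ?i"
      by (simp add: single_add[symmetric] add.assoc)
    also have "\<dots> = (w' + ?i) + Poly_Mapping.single j k" unfolding v(3) by (simp add: add_ac)
    also have "\<dots> = w + Poly_Mapping.single j (Suc k)"
      unfolding w'(2)[symmetric] by (simp add: single_add[symmetric] add.assoc)
    finally show ?thesis using v by blast
  qed
qed

text \<open>Starting from an exponent of \<open>h\<close> outside \<open>W\<close>, the chain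
  argument runs along the line in both directions and reaches an end on each side. Given both ends,
  \<open>conv\<close> puts the end \<open>v\<close> into \<open>W\<close>, a contradiction.\<close>

lemma binomial_regular:
  fixes h :: "'k::field mpoly"
  assumes W: "\<And>w. w \<in> W \<Longrightarrow> w + Poly_Mapping.single i 1 \<in> W"
      "\<And>w. w \<in> W \<Longrightarrow> w + Poly_Mapping.single j 1 \<in> W"
    and conv: "\<And>v w k. v + Poly_Mapping.single j 1 \<in> W \<Longrightarrow> w \<in> W \<Longrightarrow>
      w + Poly_Mapping.single j k = v + Poly_Mapping.single i (Suc k) \<Longrightarrow> v \<in> W"
    and h: "Poly_Mapping.keys (h * (var j - var i)) \<subseteq> W" and "i \<noteq> j"
  shows "Poly_Mapping.keys h \<subseteq> W"
proof (rule ccontr)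
  assume "\<not> Poly_Mapping.keys h \<subseteq> W"
  then obtain w where w: "w \<in> Poly_Mapping.keys h" "w \<notin> W" by blast
  have "h * (var i - var j) = - (h * (var j - var i))" by (simp add: algebra_simps)
  then have h': "Poly_Mapping.keys (h * (var i - var j)) \<subseteq> W" using h by (simp add: in_keys_iff subset_iff)
  obtain v k where v: "v \<notin> W" "v + Poly_Mapping.single j 1 \<in> W"
      "v + Poly_Mapping.single i k = w + Poly_Mapping.single j k"
    using binomial_chain[OF W(1) h \<open>i \<noteq> j\<close> w] by blast
  obtain v' k' where v': "v' + Poly_Mapping.single i 1 \<in> W"
      "v' + Poly_Mapping.single j k' = w + Poly_Mapping.single i k'"
    using binomial_chain[OF W(2) h' _ w] \<open>i \<noteq> j\<close> by blast
  have "(v' + Poly_Mapping.single i 1) + Poly_Mapping.single j (k' + k)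
      = (v' + Poly_Mapping.single j k') + (Poly_Mapping.single i 1 + Poly_Mapping.single j k)"
    by (simp add: single_add add_ac)
  also have "\<dots> = (w + Poly_Mapping.single j k) + Poly_Mapping.single i (Suc k')"
    using single_add[of i k' 1] unfolding v'(2) by (simp add: add_ac)
  also have "\<dots> = v + Poly_Mapping.single i (Suc (k' + k))"
    unfolding v(3)[symmetric] using single_add[of i "Suc k'" k] by (simp add: add_ac)
  finally show False using conv[OF v(2) v'(1)] v(1) by blast
qed

text \<open>A form of the condition \<open>conv\<close> of \<open>binomial_regular\<close> with
  \<open>i = 0\<close>, stated before \<open>merge P\<close> is applied: the exponents at
  \<open>0\<close> and in \<open>P\<close> are left free because the substitution only sees their
  sum.\<close>

definition separated :: "(nat \<Rightarrow>\<^sub>0 nat) set \<Rightarrow> nat set \<Rightarrow> nat \<Rightarrow> bool" where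
  "separated U P j \<longleftrightarrow> (\<forall>w w'. w + Poly_Mapping.single j 1 \<in> U \<longrightarrow> w' \<in> U \<longrightarrow>
     (\<forall>i. i \<notin> P \<longrightarrow> i \<noteq> 0 \<longrightarrow> i \<noteq> j \<longrightarrow> Poly_Mapping.lookup w' i = Poly_Mapping.lookup w i) \<longrightarrow>
     Poly_Mapping.lookup w' j \<le> Poly_Mapping.lookup w j \<longrightarrow> w \<in> U)"

lemma poly_mapping_split_single:
  fixes w :: "'a \<Rightarrow>\<^sub>0 nat"
  assumes "n \<le> Poly_Mapping.lookup w j"
  shows "w = (w - Poly_Mapping.single j n) + Poly_Mapping.single j n"
  by (rule poly_mapping_eqI) (use assms in \<open>auto simp: lookup_add lookup_minus lookup_single when_def\<close>)

text \<open>\<open>J\<close> is a preimage under the substitution, which fixes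
  \<open>var j - var 0\<close>, so \<open>binomial_regular\<close> can be applied to the substituted
  exponents.\<close>

lemma ideal_colon_binomial:
  fixes U :: "(nat \<Rightarrow>\<^sub>0 nat) set"
  assumes U: "exp_ideal N U" and P: "P \<subseteq> {1..<N}" and j: "j \<in> {1..<N} - P"
    and sep: "separated U P j"
    and J: "J = ideal_gen N (mon_span U \<union> (\<lambda>i. var i - var 0 :: 'k::field mpoly) ` P)"
  shows "ideal_colon N J (var j - var 0) = J"
proof -
  let ?W = "merge P ` U"
  have P': "0 \<notin> P" "finite P" "P \<subseteq> {..<N}" using P finite_subset by auto
  have N: "0 < N" using j by auto
  have J_eq: "J = {p \<in> polyring N. push (merge P) p \<in> mon_span ?W}"
    unfolding J by (rule ideal_gen_binomials[OF U P'(3) N])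
  have Ji: "is_ideal N J"
    unfolding J using P N is_idealD(1)[OF mon_span_is_ideal[OF U]]
    by (intro is_ideal_ideal_gen) (auto intro!: polyring_diff)
  have shift: "w + Poly_Mapping.single i 1 \<in> ?W" if w: "w \<in> ?W" and i: "i < N" "i \<notin> P" for w i
  proof -
    obtain v where v: "v \<in> U" "w = merge P v" using w by blast
    have "w + Poly_Mapping.single i 1 = merge P (v + Poly_Mapping.single i 1)"
      using i v by (simp add: merge_add)
    moreover have "v + Poly_Mapping.single i 1 \<in> U" using U v i by (simp add: exp_ideal_def)
    ultimately show ?thesis by blast
  qed
  have conv: "v \<in> ?W" if v: "v + Poly_Mapping.single j 1 \<in> ?W" and w: "w \<in> ?W"
    and eq: "w + Poly_Mapping.single j k = v + Poly_Mapping.single 0 (Suc k)" for v w k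
  proof -
    note lm = lookup_merge[OF P'(1,2)]
    obtain v1 where v1: "v1 \<in> U" "v + Poly_Mapping.single j 1 = merge P v1" using v by blast
    have "Poly_Mapping.lookup v1 j = Poly_Mapping.lookup (v + Poly_Mapping.single j 1) j"
      using j unfolding v1(2) lm by auto
    then have "1 \<le> Poly_Mapping.lookup v1 j" by (simp add: lookup_add)
    \<comment> \<open>As \<open>j\<close> is outside \<open>P\<close>, the substitution keeps the
      exponent at \<open>j\<close>. Hence \<open>v1\<close> is divisible by variable
      \<open>j\<close>, and the quotient \<open>v2\<close> is a lift of \<open>v\<close>.\<close>
    then obtain v2 where v2: "v1 = v2 + Poly_Mapping.single j 1"
      by (metis poly_mapping_split_single)
    have v_eq: "v = merge P v2" using v1(2) j unfolding v2 merge_add by simp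
    obtain w2 where w2: "w2 \<in> U" "w = merge P w2" using w by blast
    have lk: "Poly_Mapping.lookup w i + (if i = j then k else 0) = Poly_Mapping.lookup v i" if "i \<noteq> 0" for i
      using arg_cong[OF eq, of "\<lambda>x. Poly_Mapping.lookup x i"] that
      by (auto simp: lookup_add lookup_single when_def split: if_splits)
    have "v2 \<in> U"
    proof (rule sep[unfolded separated_def, rule_format])
      show "v2 + Poly_Mapping.single j 1 \<in> U" using v1(1) v2 by simp
      show "w2 \<in> U" by fact
      show "Poly_Mapping.lookup w2 i = Poly_Mapping.lookup v2 i" if "i \<notin> P" "i \<noteq> 0" "i \<noteq> j" for i
        using lk[of i] that unfolding w2(2) v_eq lm by simp
      show "Poly_Mapping.lookup w2 j \<le> Poly_Mapping.lookup v2 j"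
        using lk[of j] j unfolding w2(2) v_eq lm by simp
    qed
    then show ?thesis using v_eq by blast
  qed
  have "p \<in> J" if p: "p \<in> polyring N" "p * (var j - var 0) \<in> J" for p
  proof -
    have "push (merge P) (p * (var j - var 0)) = push (merge P) p * (var j - var 0)"
      using j P'(1) by (simp add: push_mult merge_add push_diff var_def)
    then have *: "Poly_Mapping.keys (push (merge P) p * (var j - var 0)) \<subseteq> ?W"
      using p(2) by (simp add: J_eq mon_span_def)
    have "Poly_Mapping.keys (push (merge P) p) \<subseteq> ?W"
    proof (rule binomial_regular[OF _ _ _ *])
      show "w + Poly_Mapping.single 0 1 \<in> ?W" if "w \<in> ?W" for w
        using that N P'(1) by (rule shift)
      show "w + Poly_Mapping.single j 1 \<in> ?W" if "w \<in> ?W" for w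
        using that by (rule shift) (use j in auto)
      show "v \<in> ?W" if "v + Poly_Mapping.single j 1 \<in> ?W" "w \<in> ?W"
        "w + Poly_Mapping.single j k = v + Poly_Mapping.single 0 (Suc k)" for v w k
        using that by (rule conv)
      show "0 \<noteq> j" using j by simp
    qed
    then show ?thesis using p(1) by (simp add: J_eq mon_span_def)
  qed
  moreover have "p * (var j - var 0) \<in> J" if "p \<in> J" for p
    using is_idealD(4)[OF Ji, of "var j - var 0" p] that j N by (simp add: mult.commute)
  ultimately show ?thesis
    using is_idealD(1)[OF Ji] by (auto simp: ideal_colon_def)
qed

section \<open>Depth of a quotient by a monomial ideal\<close>

lemma max_hom_ideal_coords:
  fixes js :: "nat set"
  assumes js: "js \<subseteq> {1..<N}" and f: "f \<in> max_hom_ideal N"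
    and z: "z = (\<lambda>i. if i \<in> js then var i - var 0 else if i < N then var i else 0 :: 'k::field mpoly)"
  shows "\<exists>g. (\<forall>i. g i \<in> polyring N) \<and> f = (\<Sum>i<N. g i * z i)"
proof -
  let ?K = "{\<Sum>i<N. g i * z i | g. \<forall>i. g i \<in> polyring N}"
  have zp: "z i \<in> polyring N" for i
    using js by (auto simp: z intro!: polyring_diff)
  have K: "is_ideal N ?K"
    unfolding is_ideal_def
  proof (intro conjI ballI)
    show "?K \<subseteq> polyring N" using zp by (auto intro!: polyring_sum)
    show "0 \<in> ?K" by (intro CollectI exI[of _ "\<lambda>_. 0"]) simp
  next
    fix x y assume "x \<in> ?K" "y \<in> ?K"
    then obtain g h where gh: "\<forall>i. g i \<in> polyring N" "x = (\<Sum>i<N. g i * z i)"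
      "\<forall>i. h i \<in> polyring N" "y = (\<Sum>i<N. h i * z i)" by blast
    then have "x + y = (\<Sum>i<N. (g i + h i) * z i)" by (simp add: distrib_right sum.distrib)
    then show "x + y \<in> ?K" using gh by (intro CollectI exI[of _ "\<lambda>i. g i + h i"]) simp
  next
    fix r x :: "'k mpoly" assume r: "r \<in> polyring N" and "x \<in> ?K"
    then obtain g where g: "\<forall>i. g i \<in> polyring N" "x = (\<Sum>i<N. g i * z i)" by blast
    then have "r * x = (\<Sum>i<N. (r * g i) * z i)" by (simp add: sum_distrib_left mult.assoc)
    then show "r * x \<in> ?K" using g r by (intro CollectI exI[of _ "\<lambda>i. r * g i"]) simp
  qed
  have z_in: "z i \<in> ?K" if "i < N" for i
  proof -
    have "(\<Sum>k<N. (if k = i then 1 else 0) * z k) = z i"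
      using that by (simp add: if_distrib[of "\<lambda>x. x * _"] sum.delta cong: if_cong)
    then show ?thesis
      by (intro CollectI exI[of _ "\<lambda>k. if k = i then 1 else 0"]) simp
  qed
  \<comment> \<open>Since \<open>0\<close> is not in \<open>js\<close>, the coordinate
    \<open>z 0\<close> is \<open>var 0\<close>, and adding it back recovers \<open>var i\<close>
    from the difference.\<close>
  have "var i \<in> ?K" if i: "i < N" for i
  proof (cases "i \<in> js")
    case True
    have "z i + z 0 \<in> ?K" using i z_in by (intro is_idealD(3)[OF K]) auto
    moreover have "z i + z 0 = var i" using True js i by (auto simp: z)
    ultimately show ?thesis by simp
  next
    case False
    then show ?thesis using z_in[OF i] i by (simp add: z)
  qed
  then have "max_hom_ideal N \<subseteq> ?K"
    unfolding max_hom_ideal_def by (intro ideal_gen_least[OF K]) auto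
  then show ?thesis using f by blast
qed

text \<open>Lower bound: the differences \<open>var j - var 0\<close> form a regular sequence, since
  \<open>separated\<close> is available for every set of variables identified earlier. Upper bound:
  \<open>monom u\<close> survives the identification of all of \<open>js\<close> and is annihilated
  by the other variables, so it yields a nonzero Koszul class.\<close>

lemma depth_quot_mon_span:
  assumes U: "exp_ideal N U" and js: "distinct js" "set js \<subseteq> {1..<N}" and N: "0 < N"
    and sep: "\<And>P j. P \<subseteq> set js \<Longrightarrow> j \<in> set js \<Longrightarrow> j \<notin> P \<Longrightarrow> separated U P j"
    and u: "u \<in> exps N" "merge (set js) u = u" "u \<notin> merge (set js) ` U"
    and killed: "\<And>i. i < N \<Longrightarrow> i \<notin> set js \<Longrightarrow> u + Poly_Mapping.single i 1 \<in> U"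
  shows "depth_quot N (mon_span U :: 'k::field mpoly set) = enat (length js)"
proof -
  define I where "I = (mon_span U :: 'k mpoly set)"
  define b :: "nat \<Rightarrow> 'k mpoly" where "b = (\<lambda>i. var i - var 0)"
  \<comment> \<open>Linear coordinates that generate the maximal ideal; they are zero from index
    \<open>N\<close> on, so that those indices annihilate \<open>monom u\<close> trivially.\<close>
  define z where "z = (\<lambda>i. if i \<in> set js then var i - var 0 else if i < N then var i else 0 :: 'k mpoly)"
  have I: "is_ideal N I" unfolding I_def by (rule mon_span_is_ideal[OF U])
  have "set js \<subseteq> {..<N}" using js(2) by auto
  note gen = ideal_gen_binomials[OF U this N, where 'k = 'k]
  have u_notin: "monom u \<notin> ideal_gen N (I \<union> b ` set js)"
    unfolding I_def b_def gen using u(2,3) by (simp add: monom_def mon_span_def)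
  have up: "monom u \<in> (polyring N :: 'k mpoly set)"
    using u(1) by (simp add: polyring_eq_mon_span)
  have "I \<subseteq> ideal_gen N (I \<union> b ` set js)"
    using ideal_gen_superset by blast
  then have proper: "I \<noteq> polyring N" "ideal_gen N (I \<union> b ` set js) \<noteq> polyring N"
    using u_notin up by auto
  have reg: "regular_seq N I (map b js)"
    unfolding regular_seq_def
  proof (intro conjI allI impI)
    have m: "is_ideal N (max_hom_ideal N)"
      unfolding max_hom_ideal_def by (rule is_ideal_ideal_gen) auto
    have "var i \<in> (max_hom_ideal N :: 'k mpoly set)" if "i < N" for i
      unfolding max_hom_ideal_def using that by (intro subsetD[OF ideal_gen_superset]) auto
    then show "set (map b js) \<subseteq> max_hom_ideal N"
      using js(2) N by (auto simp: b_def intro!: is_ideal_diff[OF m])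
    show "ideal_gen N (I \<union> set (map b js)) \<noteq> polyring N" using proper by simp
    fix k assume k: "k < length (map b js)"
    let ?P = "set (take k js)"
    have P: "?P \<subseteq> set js" by (rule set_take_subset)
    have nth: "js ! k \<in> set js" "js ! k \<notin> ?P"
      using k js(1) by (auto simp: in_set_conv_nth nth_eq_iff_index_eq)
    have "ideal_colon N (ideal_gen N (I \<union> b ` ?P)) (b (js ! k)) = ideal_gen N (I \<union> b ` ?P)"
      unfolding I_def b_def
      by (rule ideal_colon_binomial[OF U _ _ sep[OF P nth] refl]) (use P nth js(2) in auto)
    then show "ideal_colon N (ideal_gen N (I \<union> set (take k (map b js)))) (map b js ! k) =
        ideal_gen N (I \<union> set (take k (map b js)))"
      using k by (simp add: take_map)
  qed
  have "length fs \<le> length js" if "regular_seq N I fs" for fs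
  proof (rule regular_seq_length_le[OF I that, where z = z and u = "monom u"])
    show "z i \<in> polyring N" for i
      using js(2) by (auto simp: z_def intro!: polyring_diff)
    show "\<exists>g. (\<forall>i. g i \<in> polyring N) \<and> f = (\<Sum>i<N. g i * z i)" if "f \<in> max_hom_ideal N" for f
      by (rule max_hom_ideal_coords[OF js(2) that z_def])
    show "distinct js" by fact
    show "monom u \<in> (polyring N :: 'k mpoly set)" by (rule up)
    show "z i * monom u \<in> I" if "i \<notin> set js" for i
    proof (cases "i < N")
      case True
      have "z i * monom u = monom (u + Poly_Mapping.single i 1)"
        using that True by (simp add: z_def var_def monom_def mult_single add.commute)
      then show ?thesis using killed[OF True that] by (simp add: I_def)
    next
      case False
      then show ?thesis using that is_idealD(2)[OF I] by (simp add: z_def)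
    qed
    have "z ` set js = b ` set js" by (simp add: z_def b_def)
    then show "monom u \<notin> ideal_gen N (I \<union> z ` set js)" using u_notin by simp
  qed
  then have "(SUP fs \<in> {fs. regular_seq N I fs}. enat (length fs)) \<le> enat (length js)"
    by (intro SUP_least) simp
  moreover have "enat (length js) \<le> (SUP fs \<in> {fs. regular_seq N I fs}. enat (length fs))"
    using reg by (intro SUP_upper2[of "map b js"]) auto
  ultimately show ?thesis
    using proper(1) by (simp add: depth_quot_def I_def)
qed

section \<open>The building blocks\<close>

text \<open>The exponents \<open>(a, b, c)\<close> of the monomials \<open>x^a y^b t^c\<close> in the \<open>n\<close>-th power of
  \<open>(x^m, x^(m-1) y, y^(m-1) t)\<close>, where \<open>s\<close>, \<open>q\<close>, \<open>r\<close> count the factors of each kind. The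
  value \<open>m = 0\<close> encodes an infinite threshold and stands for \<open>(x, y)\<close>.\<close>

definition piece :: "nat \<Rightarrow> nat \<Rightarrow> nat \<Rightarrow> nat \<Rightarrow> nat \<Rightarrow> bool" where
  "piece m n a b c \<longleftrightarrow> (\<exists>r s q. r + s + q = n \<and> (m = 0 \<longrightarrow> r = 0) \<and>
     s * Suc (m - 1) + q * (m - 1) \<le> a \<and> q + (m - 1) * r \<le> b \<and> r \<le> c)"

definition alive :: "nat \<Rightarrow> nat \<Rightarrow> bool" where
  "alive m n \<longleftrightarrow> m = 0 \<or> n < m"

lemma piece_0: "piece m 0 a b c"
  by (auto simp: piece_def)

lemma piece_mono: "piece m n a b c \<Longrightarrow> a \<le> a' \<Longrightarrow> b \<le> b' \<Longrightarrow> c \<le> c' \<Longrightarrow> piece m n a' b' c'"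
  unfolding piece_def by (elim exE conjE, intro exI conjI) (assumption | erule order_trans | simp)+

lemma piece_add:
  assumes "piece m n a b c" "piece m n' a' b' c'"
  shows "piece m (n + n') (a + a') (b + b') (c + c')"
proof -
  obtain r s q r' s' q' where *: "r + s + q = n" "m = 0 \<longrightarrow> r = 0"
    "s * Suc (m - 1) + q * (m - 1) \<le> a" "q + (m - 1) * r \<le> b" "r \<le> c"
    "r' + s' + q' = n'" "m = 0 \<longrightarrow> r' = 0"
    "s' * Suc (m - 1) + q' * (m - 1) \<le> a'" "q' + (m - 1) * r' \<le> b'" "r' \<le> c'"
    using assms unfolding piece_def by blast
  have "(s + s') * Suc (m - 1) + (q + q') * (m - 1) \<le> a + a'"
    using add_mono[OF *(3) *(8)] by (simp add: distrib_right)
  moreover have "(q + q') + (m - 1) * (r + r') \<le> b + b'"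
    using add_mono[OF *(4) *(9)] by (simp add: distrib_left)
  ultimately show ?thesis
    unfolding piece_def using *
    by (intro exI[of _ "r + r'"] exI[of _ "s + s'"] exI[of _ "q + q'"]) auto
qed

lemma piece_Suc:
  assumes "piece m (Suc n) a b c"
  shows "\<exists>a' b' c'. a' \<le> a \<and> b' \<le> b \<and> c' \<le> c \<and> piece m 1 a' b' c' \<and> piece m n (a - a') (b - b') (c - c')"
proof -
  define v where "v = m - 1"
  obtain r s q where *: "r + s + q = Suc n" "m = 0 \<longrightarrow> r = 0"
    "s * Suc v + q * v \<le> a" "q + v * r \<le> b" "r \<le> c"
    using assms unfolding piece_def v_def by blast
  consider r' where "r = Suc r'" | s' where "s = Suc s'" | q' where "q = Suc q'"
    using *(1) by (cases r; cases s; cases q) auto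
  then show ?thesis
  proof cases
    case 1
    then have "piece m 1 0 v 1" unfolding piece_def v_def
      using * by (intro exI[of _ 1] exI[of _ 0]) auto
    moreover have "piece m n a (b - v) (c - 1)" unfolding piece_def v_def[symmetric]
      using * 1 by (intro exI[of _ r'] exI[of _ s] exI[of _ q]) auto
    ultimately show ?thesis
      using * 1 by (intro exI[of _ 0] exI[of _ v] exI[of _ 1]) auto
  next
    case 2
    then have "piece m 1 (Suc v) 0 0" unfolding piece_def v_def
      by (intro exI[of _ 0] exI[of _ 1]) auto
    moreover have "piece m n (a - Suc v) b c" unfolding piece_def v_def[symmetric]
      using * 2 by (intro exI[of _ r] exI[of _ s'] exI[of _ q]) auto
    ultimately show ?thesis
      using * 2 by (intro exI[of _ "Suc v"] exI[of _ 0]) auto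
  next
    case 3
    then have "piece m 1 v 1 0" unfolding piece_def v_def
      by (intro exI[of _ 0] exI[of _ 1]) auto
    moreover have "piece m n (a - v) (b - 1) c" unfolding piece_def v_def[symmetric]
      using * 3 by (intro exI[of _ r] exI[of _ s] exI[of _ q']) auto
    ultimately show ?thesis
      using * 3 by (intro exI[of _ v] exI[of _ 1] exI[of _ 0]) auto
  qed
qed

text \<open>While the piece is alive the monomials of each \<open>x\<close>-degree form a principal ideal: trading a
  factor \<open>y^(m-1) t\<close> for \<open>n < m\<close> factors of the other two kinds never raises the \<open>y\<close>-degree.\<close>

lemma piece_alive:
  assumes "alive m n" "piece m n a b c" "piece m n a b' c'"
  shows "piece m n a b c'"
proof -
  define v where "v = m - 1"
  obtain r s q r' s' q' where *: "r + s + q = n" "m = 0 \<longrightarrow> r = 0"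
    "s * Suc v + q * v \<le> a" "q + v * r \<le> b" "r \<le> c"
    "r' + s' + q' = n" "m = 0 \<longrightarrow> r' = 0"
    "s' * Suc v + q' * v \<le> a" "q' + v * r' \<le> b'" "r' \<le> c'"
    using assms(2,3) unfolding piece_def v_def by blast
  show ?thesis
  proof (cases "r \<le> r'")
    case True
    then show ?thesis
      unfolding piece_def v_def[symmetric] using *
      by (intro exI[of _ r] exI[of _ s] exI[of _ q]) auto
  next
    case False
    then obtain d where d: "r = r' + Suc d" using less_imp_Suc_add[of r' r] by auto
    have "n \<le> v" using assms(1) d *(2) by (auto simp: alive_def v_def)
    then have "q' + v * r' \<le> v * r" using *(6) unfolding d by (auto simp: algebra_simps)
    then have "q' + v * r' \<le> b" using *(4) by simp
    then show ?thesis
      unfolding piece_def v_def[symmetric] using *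
      by (intro exI[of _ r'] exI[of _ s'] exI[of _ q']) auto
  qed
qed

text \<open>The socle monomial of \<open>R/Q^n\<close> will have \<open>x\<^sub>j\<close>-degree \<open>top_x (m j) n\<close> and \<open>y\<close>-degree
  \<open>(\<Sum>j<s. top_y (m j) n) - 1\<close>.\<close>

definition top_x :: "nat \<Rightarrow> nat \<Rightarrow> nat" where
  "top_x m n = (if alive m n then n * Suc (m - 1) - 1 else (n - 1) * m)"

definition top_y :: "nat \<Rightarrow> nat \<Rightarrow> nat" where
  "top_y m n = (if alive m n then 1 else m)"

text \<open>Alive: \<open>n - 1\<close> pure powers of \<open>x\<close> and one mixed factor.
  Otherwise: \<open>m\<close> factors \<open>x^(m-1) y\<close> and \<open>n - m\<close> factors
  \<open>x^m\<close>. One more \<open>x\<close> turns a mixed factor into a pure one; one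
  \<open>t\<close> permits \<open>n - 1\<close> factors \<open>x^m\<close> and one factor
  \<open>y^(m-1) t\<close>. Either change saves one \<open>y\<close>.\<close>

lemma piece_top:
  assumes "1 \<le> n"
  shows "piece m n (top_x m n) (top_y m n) 0"
    and "piece m n (Suc (top_x m n)) (top_y m n - 1) 0"
    and "\<not> alive m n \<Longrightarrow> piece m n (top_x m n) (top_y m n - 1) 1"
proof -
  obtain n' where n: "n = Suc n'" using assms by (cases n) auto
  show "piece m n (top_x m n) (top_y m n) 0"
  proof (cases "alive m n")
    case True
    then show ?thesis unfolding piece_def n
      by (intro exI[of _ 0] exI[of _ n'] exI[of _ 1]) (auto simp: top_x_def top_y_def)
  next
    case False
    then obtain v k where m: "m = Suc v" "n = m + k"
      by (cases m) (auto simp: alive_def not_less dest: le_Suc_ex)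
    show ?thesis unfolding piece_def
      using False m by (intro exI[of _ 0] exI[of _ k] exI[of _ m]) (auto simp: top_x_def top_y_def algebra_simps)
  qed
  show "piece m n (Suc (top_x m n)) (top_y m n - 1) 0"
  proof (cases "alive m n")
    case True
    then show ?thesis unfolding piece_def n
      by (intro exI[of _ 0] exI[of _ "Suc n'"]) (auto simp: top_x_def top_y_def)
  next
    case False
    then obtain v k where m: "m = Suc v" "n = m + k"
      by (cases m) (auto simp: alive_def not_less dest: le_Suc_ex)
    show ?thesis unfolding piece_def
      using False m by (intro exI[of _ 0] exI[of _ "Suc k"] exI[of _ v]) (auto simp: top_x_def top_y_def algebra_simps)
  qed
  assume dead: "\<not> alive m n"
  then obtain v where m: "m = Suc v" by (cases m) (auto simp: alive_def)
  show "piece m n (top_x m n) (top_y m n - 1) 1"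
    unfolding piece_def using dead m n
    by (intro exI[of _ 1] exI[of _ n'] exI[of _ 0]) (auto simp: top_x_def top_y_def)
qed

text \<open>Alive: without \<open>y\<close> and \<open>t\<close> all factors would be pure powers of
  \<open>x\<close>, whose degree exceeds \<open>top_x\<close> by one. Otherwise no \<open>t\<close>
  is available, and \<open>n\<close> factors of total \<open>x\<close>-degree at most
  \<open>(n - 1) * m\<close> include at least \<open>m\<close> mixed ones, each costing one
  \<open>y\<close>.\<close>

lemma piece_top_le:
  assumes "1 \<le> n" "piece m n (top_x m n) b c" "\<not> alive m n \<Longrightarrow> c = 0"
  shows "top_y m n \<le> b + c"
proof -
  define v where "v = m - 1"
  obtain n' where n: "n = Suc n'" using assms by (cases n) auto
  obtain r s q where *: "r + s + q = n" "s * Suc v + q * v \<le> top_x m n" "q + v * r \<le> b" "r \<le> c"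
    using assms(2) unfolding piece_def v_def by blast
  show ?thesis
  proof (cases "alive m n")
    case True
    have "1 \<le> b + c"
    proof (rule ccontr)
      assume "\<not> 1 \<le> b + c"
      then have "s = n" using * by auto
      then show False using * True n by (simp add: top_x_def v_def)
    qed
    then show ?thesis using True by (simp add: top_y_def)
  next
    case False
    then have r: "r = 0" and m: "m = Suc v" using * assms(3) by (auto simp: alive_def v_def)
    have "s * Suc v + q * v + q = n * m" using *(1) r m by (simp add: algebra_simps flip: *(1))
    then have "m \<le> q" using *(2) False n by (simp add: top_x_def)
    then show ?thesis using *(3) False by (simp add: top_y_def)
  qed
qed

section \<open>The ideal\<close>

text \<open>The variables are \<open>y\<close> with index \<open>0\<close>, and \<open>t\<^sub>j\<close>, \<open>x\<^sub>j\<close> with indices \<open>2j + 1\<close>, \<open>2j + 2\<close>;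
  \<open>b j\<close> is the share of the \<open>y\<close>-exponent used for the \<open>j\<close>-th factor.\<close>

definition prod_exps :: "(nat \<Rightarrow> nat) \<Rightarrow> nat \<Rightarrow> nat \<Rightarrow> (nat \<Rightarrow>\<^sub>0 nat) set" where
  "prod_exps m s n = {w \<in> exps (2 * s + 1). \<exists>b.
     (\<forall>j<s. piece (m j) n (Poly_Mapping.lookup w (2 * j + 2)) (b j) (Poly_Mapping.lookup w (2 * j + 1))) \<and>
     (\<Sum>j<s. b j) \<le> Poly_Mapping.lookup w 0}"

lemma prod_expsI:
  assumes "w \<in> exps (2 * s + 1)"
    and "\<And>j. j < s \<Longrightarrow>
      piece (m j) n (Poly_Mapping.lookup w (2 * j + 2)) (b j) (Poly_Mapping.lookup w (2 * j + 1))"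
    and "(\<Sum>j<s. b j) \<le> Poly_Mapping.lookup w 0"
  shows "w \<in> prod_exps m s n"
  using assms by (auto simp: prod_exps_def)

lemma exps_iff_lookup: "w \<in> exps N \<longleftrightarrow> (\<forall>i\<ge>N. Poly_Mapping.lookup w i = 0)"
  unfolding exps_def by (auto simp: in_keys_iff subset_iff not_le)

lemma variable_cases:
  "i < 2 * s + 1 \<Longrightarrow> i = 0 \<or> (\<exists>j<s. i = 2 * j + 1) \<or> (\<exists>j<s. i = 2 * j + (2::nat))"
  by presburger

lemma exps_of_fun:
  fixes h :: "nat \<Rightarrow> nat"
  shows "\<exists>w\<in>exps N. \<forall>i<N. Poly_Mapping.lookup w i = h i"
proof (intro bexI allI impI)
  let ?w = "\<Sum>i<N. Poly_Mapping.single i (h i)"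
  have lk: "Poly_Mapping.lookup ?w k = (if k < N then h k else 0)" for k
    by (simp add: lookup_sum lookup_single when_def)
  then show "?w \<in> exps N" by (simp add: exps_iff_lookup)
  show "Poly_Mapping.lookup ?w i = h i" if "i < N" for i using lk that by simp
qed

lemma exp_ideal_prod_exps: "exp_ideal (2 * s + 1) (prod_exps m s n)"
  unfolding exp_ideal_def
proof (intro conjI ballI)
  show "prod_exps m s n \<subseteq> exps (2 * s + 1)" by (auto simp: prod_exps_def)
  fix w v assume w: "w \<in> prod_exps m s n" and v: "v \<in> exps (2 * s + 1)"
  obtain b where b: "w \<in> exps (2 * s + 1)"
    "\<And>j. j < s \<Longrightarrow> piece (m j) n (Poly_Mapping.lookup w (2 * j + 2)) (b j) (Poly_Mapping.lookup w (2 * j + 1))"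
    "(\<Sum>j<s. b j) \<le> Poly_Mapping.lookup w 0"
    using w unfolding prod_exps_def by blast
  show "w + v \<in> prod_exps m s n"
  proof (rule prod_expsI)
    show "piece (m j) n (Poly_Mapping.lookup (w + v) (2 * j + 2)) (b j)
        (Poly_Mapping.lookup (w + v) (2 * j + 1))" if "j < s" for j
      by (rule piece_mono[OF b(2)[OF that]]) (simp_all add: lookup_add)
  qed (use b v in \<open>auto simp: lookup_add\<close>)
qed

lemma prod_exps_0: "prod_exps m s 0 = exps (2 * s + 1)"
  by (auto simp: prod_exps_def piece_0 intro: exI[of _ "\<lambda>_. 0"])

text \<open>To split, \<open>piece_Suc\<close> removes one generator from each block; the shares of
  the \<open>y\<close>-exponent are split accordingly, and surplus \<open>y\<close> stays with the
  \<open>n\<close>-th power.\<close>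

lemma prod_exps_Suc:
  "prod_exps m s (Suc n) = {v + w | v w. v \<in> prod_exps m s n \<and> w \<in> prod_exps m s 1}"
proof (intro subset_antisym subsetI)
  fix w assume "w \<in> prod_exps m s (Suc n)"
  then obtain b where w: "w \<in> exps (2 * s + 1)" and
    piece: "\<And>j. j < s \<Longrightarrow> piece (m j) (Suc n) (Poly_Mapping.lookup w (2 * j + 2)) (b j) (Poly_Mapping.lookup w (2 * j + 1))"
    and b: "(\<Sum>j<s. b j) \<le> Poly_Mapping.lookup w 0"
    unfolding prod_exps_def by blast
  obtain a' b' c' where split:
    "\<And>j. j < s \<Longrightarrow> a' j \<le> Poly_Mapping.lookup w (2 * j + 2)"
    "\<And>j. j < s \<Longrightarrow> b' j \<le> b j" "\<And>j. j < s \<Longrightarrow> c' j \<le> Poly_Mapping.lookup w (2 * j + 1)"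
    "\<And>j. j < s \<Longrightarrow> piece (m j) 1 (a' j) (b' j) (c' j)"
    "\<And>j. j < s \<Longrightarrow> piece (m j) n (Poly_Mapping.lookup w (2 * j + 2) - a' j) (b j - b' j)
      (Poly_Mapping.lookup w (2 * j + 1) - c' j)"
    using piece_Suc[OF piece] by metis
  \<comment> \<open>The exponents of the product of the split-off generators, in the interleaved
    numbering of the variables.\<close>
  define h where "h = (\<lambda>i. if i = 0 then \<Sum>j<s. b' j else if odd i then c' (i div 2) else a' (i div 2 - 1))"
  obtain w2 where w2: "w2 \<in> exps (2 * s + 1)" "\<And>i. i < 2 * s + 1 \<Longrightarrow> Poly_Mapping.lookup w2 i = h i"
    using exps_of_fun[of "2 * s + 1" h] by blast
  have h: "h 0 = (\<Sum>j<s. b' j)" "h (2 * j + 1) = c' j" "h (2 * j + 2) = a' j" for j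
    by (auto simp: h_def)
  have sum_b': "(\<Sum>j<s. b' j) \<le> (\<Sum>j<s. b j)" using split(2) by (intro sum_mono) auto
  have le: "Poly_Mapping.lookup w2 i \<le> Poly_Mapping.lookup w i" for i
  proof (cases "i < 2 * s + 1")
    case True
    consider "i = 0" | j where "i = 2 * j + 1" "j < s" | j where "i = 2 * j + 2" "j < s"
      using variable_cases[of i s] True by blast
    then show ?thesis
      using w2(2)[OF True] h sum_b' b split(1,3) by cases auto
  next
    case False
    then show ?thesis using w2(1) by (auto simp: exps_iff_lookup not_less)
  qed
  have "w = (w - w2) + w2"
    by (rule poly_mapping_eqI) (simp add: lookup_add lookup_minus le)
  moreover have "w2 \<in> prod_exps m s 1"
    by (rule prod_expsI[where b = b']) (use w2 h split in auto)
  moreover have "w - w2 \<in> prod_exps m s n"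
  proof (rule prod_expsI[where b = "\<lambda>j. b j - b' j"])
    show "w - w2 \<in> exps (2 * s + 1)" using w by (auto simp: exps_iff_lookup lookup_minus)
    show "piece (m j) n (Poly_Mapping.lookup (w - w2) (2 * j + 2)) (b j - b' j)
        (Poly_Mapping.lookup (w - w2) (2 * j + 1))" if "j < s" for j
      using split(5)[OF that] w2(2)[of "2 * j + 2"] w2(2)[of "2 * j + 1"] h that by (simp add: lookup_minus)
    have "(\<Sum>j<s. b j - b' j) = (\<Sum>j<s. b j) - (\<Sum>j<s. b' j)"
      using split(2) by (intro sum_subtractf_nat) auto
    then show "(\<Sum>j<s. b j - b' j) \<le> Poly_Mapping.lookup (w - w2) 0"
      using b w2(2)[of 0] h(1) by (simp add: lookup_minus)
  qed
  ultimately show "w \<in> {v + w | v w. v \<in> prod_exps m s n \<and> w \<in> prod_exps m s 1}" by blast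
next
  fix x assume "x \<in> {v + w | v w. v \<in> prod_exps m s n \<and> w \<in> prod_exps m s 1}"
  then obtain v w where x: "x = v + w" and v: "v \<in> prod_exps m s n" and w: "w \<in> prod_exps m s 1" by blast
  obtain b where b: "v \<in> exps (2 * s + 1)"
    "\<And>j. j < s \<Longrightarrow> piece (m j) n (Poly_Mapping.lookup v (2 * j + 2)) (b j) (Poly_Mapping.lookup v (2 * j + 1))"
    "(\<Sum>j<s. b j) \<le> Poly_Mapping.lookup v 0"
    using v unfolding prod_exps_def by blast
  obtain b' where b': "w \<in> exps (2 * s + 1)"
    "\<And>j. j < s \<Longrightarrow> piece (m j) 1 (Poly_Mapping.lookup w (2 * j + 2)) (b' j) (Poly_Mapping.lookup w (2 * j + 1))"
    "(\<Sum>j<s. b' j) \<le> Poly_Mapping.lookup w 0"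
    using w unfolding prod_exps_def by blast
  show "x \<in> prod_exps m s (Suc n)"
    unfolding x
  proof (rule prod_expsI[where b = "\<lambda>j. b j + b' j"])
    show "piece (m j) (Suc n) (Poly_Mapping.lookup (v + w) (2 * j + 2)) (b j + b' j)
        (Poly_Mapping.lookup (v + w) (2 * j + 1))" if "j < s" for j
      using piece_add[OF b(2)[OF that] b'(2)[OF that]] by (simp add: lookup_add)
  qed (use b b' in \<open>auto simp: lookup_add sum.distrib\<close>)
qed

text \<open>Only block \<open>j\<close> is affected. Its \<open>y\<close>-share comes from
  \<open>w\<close> times the variable \<open>t\<close> of the block, its \<open>t\<close>-exponent
  from \<open>w'\<close>, and the \<open>x\<close>-exponents agree because \<open>x\<close> has even
  index and so lies outside \<open>P\<close>; \<open>piece_alive\<close> combines the two.\<close>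

lemma separated_prod_exps:
  assumes j: "j < s" "alive (m j) n" and P: "\<And>i. i \<in> P \<Longrightarrow> odd i"
  shows "separated (prod_exps m s n) P (2 * j + 1)"
  unfolding separated_def
proof (intro allI impI)
  fix w w'
  assume w: "w + Poly_Mapping.single (2 * j + 1) 1 \<in> prod_exps m s n" and w': "w' \<in> prod_exps m s n"
    and eq: "\<forall>i. i \<notin> P \<longrightarrow> i \<noteq> 0 \<longrightarrow> i \<noteq> 2 * j + 1 \<longrightarrow> Poly_Mapping.lookup w' i = Poly_Mapping.lookup w i"
    and le: "Poly_Mapping.lookup w' (2 * j + 1) \<le> Poly_Mapping.lookup w (2 * j + 1)"
  let ?w = "w + Poly_Mapping.single (2 * j + 1) 1"
  have lk: "Poly_Mapping.lookup ?w i = Poly_Mapping.lookup w i + (if i = 2 * j + 1 then 1 else 0)" for i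
    by (simp add: lookup_add lookup_single when_def)
  obtain b where b: "?w \<in> exps (2 * s + 1)"
    "\<And>i. i < s \<Longrightarrow> piece (m i) n (Poly_Mapping.lookup ?w (2 * i + 2)) (b i) (Poly_Mapping.lookup ?w (2 * i + 1))"
    "(\<Sum>i<s. b i) \<le> Poly_Mapping.lookup ?w 0"
    using w unfolding prod_exps_def by blast
  obtain b' where b': "\<And>i. i < s \<Longrightarrow>
      piece (m i) n (Poly_Mapping.lookup w' (2 * i + 2)) (b' i) (Poly_Mapping.lookup w' (2 * i + 1))"
    using w' unfolding prod_exps_def by blast
  have "2 * j + 2 \<notin> P" using P[of "2 * j + 2"] by auto
  then have x: "Poly_Mapping.lookup w' (2 * j + 2) = Poly_Mapping.lookup w (2 * j + 2)" using eq by simp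
  have "2 * j + 2 \<noteq> 2 * i + 1" for i by presburger
  then have lk_even: "Poly_Mapping.lookup ?w (2 * i + 2) = Poly_Mapping.lookup w (2 * i + 2)" for i
    unfolding lk by presburger
  have piece_j: "piece (m j) n (Poly_Mapping.lookup w (2 * j + 2)) (b j) (Poly_Mapping.lookup w (2 * j + 1))"
  proof (rule piece_mono[OF _ order_refl order_refl le])
    show "piece (m j) n (Poly_Mapping.lookup w (2 * j + 2)) (b j) (Poly_Mapping.lookup w' (2 * j + 1))"
      using b(2)[OF j(1)] b'[OF j(1)] unfolding x lk_even by (rule piece_alive[OF j(2)])
  qed
  show "w \<in> prod_exps m s n"
  proof (rule prod_expsI)
    show "w \<in> exps (2 * s + 1)"
      using b(1) unfolding exps_iff_lookup lk by simp
    show "(\<Sum>i<s. b i) \<le> Poly_Mapping.lookup w 0" using b(3) unfolding lk by simp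
    show "piece (m i) n (Poly_Mapping.lookup w (2 * i + 2)) (b i) (Poly_Mapping.lookup w (2 * i + 1))"
      if "i < s" for i
      using b(2)[OF that] piece_j unfolding lk_even unfolding lk by (cases "i = j") auto
  qed
qed

text \<open>The \<open>y\<close>-exponent of \<open>u\<close> is one less than the amount
  \<open>Y\<close> demanded by its \<open>x\<close>-exponents, even if the \<open>t\<close> of alive
  blocks count as \<open>y\<close>. Multiplying by \<open>y\<close> supplies the missing unit;
  multiplying by some \<open>x\<close>, or by the \<open>t\<close> of a dead block, lowers the
  demand by one.\<close>

lemma depth_quot_prod_exps:
  assumes s: "0 < s" and n: "1 \<le> n"
  shows "depth_quot (2 * s + 1) (mon_span (prod_exps m s n) :: 'k::field mpoly set)
    = enat (card {j. j < s \<and> alive (m j) n})"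
proof -
  define A where "A = {j. j < s \<and> alive (m j) n}"
  define js where "js = map (\<lambda>j. 2 * j + 1) (sorted_list_of_set A)"
  have A: "finite A" "A \<subseteq> {..<s}" by (auto simp: A_def)
  have set_js: "set js = (\<lambda>j. 2 * j + 1) ` A" using A by (simp add: js_def)
  have fin: "0 \<notin> set js" "finite (set js)" by (auto simp: js_def)
  define Y where "Y = (\<Sum>j<s. top_y (m j) n)"
  have top_y_pos: "1 \<le> top_y (m j) n" for j by (auto simp: top_y_def alive_def)
  have "top_y (m 0) n \<le> Y" unfolding Y_def using s by (intro member_le_sum) auto
  then have Y: "1 \<le> Y" using top_y_pos[of 0] by simp
  define h where "h = (\<lambda>i. if i = 0 then Y - 1 else if odd i then 0 else top_x (m (i div 2 - 1)) n)"
  obtain u where u: "u \<in> exps (2 * s + 1)" "\<And>i. i < 2 * s + 1 \<Longrightarrow> Poly_Mapping.lookup u i = h i"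
    using exps_of_fun[of "2 * s + 1" h] by blast
  have u0: "Poly_Mapping.lookup u 0 = Y - 1" using u(2)[of 0] by (simp add: h_def)
  have ut: "Poly_Mapping.lookup u (2 * j + 1) = 0"
    and ux: "Poly_Mapping.lookup u (2 * j + 2) = top_x (m j) n" if "j < s" for j
    using that u(2)[of "2 * j + 1"] u(2)[of "2 * j + 2"] by (auto simp: h_def)
  have merge_u: "merge (set js) u = u"
  proof (rule poly_mapping_eqI)
    have "Poly_Mapping.lookup u i = 0" if "i \<in> set js" for i
      using that A ut by (auto simp: set_js)
    then show "Poly_Mapping.lookup (merge (set js) u) i = Poly_Mapping.lookup u i" for i
      by (auto simp: lookup_merge[OF fin])
  qed
  have u_notin: "u \<notin> merge (set js) ` prod_exps m s n"
  proof
    assume "u \<in> merge (set js) ` prod_exps m s n"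
    then obtain w where w: "u = merge (set js) w" "w \<in> prod_exps m s n" by blast
    obtain b where b: "\<And>j. j < s \<Longrightarrow>
        piece (m j) n (Poly_Mapping.lookup w (2 * j + 2)) (b j) (Poly_Mapping.lookup w (2 * j + 1))"
      "(\<Sum>j<s. b j) \<le> Poly_Mapping.lookup w 0"
      using w(2) unfolding prod_exps_def by blast
    have lw: "Poly_Mapping.lookup u i = Poly_Mapping.lookup w i" if "i \<notin> set js" "i \<noteq> 0" for i
      using that unfolding w(1) lookup_merge[OF fin] by simp
    have dead: "Poly_Mapping.lookup w (2 * j + 1) = 0" if "j < s" "j \<notin> A" for j
    proof -
      have "2 * j + 1 \<notin> set js" using that by (auto simp: set_js)
      then show ?thesis using that lw[of "2 * j + 1"] ut[of j] by simp
    qed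
    have "top_y (m j) n \<le> b j + Poly_Mapping.lookup w (2 * j + 1)" if j: "j < s" for j
    proof (rule piece_top_le[OF n])
      have "2 * j + 2 \<notin> set js" unfolding set_js by (auto, presburger)
      then show "piece (m j) n (top_x (m j) n) (b j) (Poly_Mapping.lookup w (2 * j + 1))"
        using b(1)[OF j] lw[of "2 * j + 2"] ux[OF j] by simp
      show "Poly_Mapping.lookup w (2 * j + 1) = 0" if "\<not> alive (m j) n"
        using that j dead by (auto simp: A_def)
    qed
    \<comment> \<open>The substitution adds the \<open>t\<close>-exponents of alive blocks to the
      \<open>y\<close>-exponent, and those of dead blocks are zero. So the demand \<open>Y\<close>
      would be met by the \<open>y\<close>-exponent of \<open>u\<close>, which is
      \<open>Y - 1\<close>.\<close>
    then have "Y \<le> (\<Sum>j<s. b j + Poly_Mapping.lookup w (2 * j + 1))"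
      unfolding Y_def by (intro sum_mono) auto
    also have "\<dots> = (\<Sum>j<s. b j) + (\<Sum>j<s. Poly_Mapping.lookup w (2 * j + 1))"
      by (rule sum.distrib)
    also have "(\<Sum>j<s. Poly_Mapping.lookup w (2 * j + 1)) = (\<Sum>j\<in>A. Poly_Mapping.lookup w (2 * j + 1))"
      using A dead by (intro sum.mono_neutral_right) auto
    also have "\<dots> = (\<Sum>i\<in>set js. Poly_Mapping.lookup w i)"
      unfolding set_js by (subst sum.reindex) (auto simp: inj_on_def)
    also have "(\<Sum>j<s. b j) + \<dots> \<le> Poly_Mapping.lookup u 0"
      using b(2) unfolding w(1) lookup_merge[OF fin] by simp
    finally show False using u0 Y by simp
  qed
  have killed: "u + Poly_Mapping.single i 1 \<in> prod_exps m s n"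
    if i: "i < 2 * s + 1" "i \<notin> set js" for i
  proof -
    have lk: "Poly_Mapping.lookup (u + Poly_Mapping.single i 1) k
        = Poly_Mapping.lookup u k + (if k = i then 1 else 0)" for k
      by (simp add: lookup_add lookup_single when_def)
    have ue: "u + Poly_Mapping.single i 1 \<in> exps (2 * s + 1)" using u(1) i by simp
    consider "i = 0" | j where "j < s" "i = 2 * j + 1" | j where "j < s" "i = 2 * j + 2"
      using variable_cases[of i s] i(1) by blast
    then show ?thesis
    proof cases
      case 1
      show ?thesis
      proof (rule prod_expsI[OF ue, where b = "\<lambda>j. top_y (m j) n"])
        show "(\<Sum>j<s. top_y (m j) n) \<le> Poly_Mapping.lookup (u + Poly_Mapping.single i 1) 0"
          using 1 u0 Y unfolding lk by (simp add: Y_def)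
      qed (use piece_top(1)[OF n] 1 ut ux lk in auto)
    next
      case (2 j)
      note j = 2
      \<comment> \<open>The extra \<open>t\<close> saves one \<open>y\<close> in the dead block
        \<open>j\<close>, so the shares sum to \<open>Y - 1\<close>.\<close>
      let ?b = "\<lambda>k. if k = j then top_y (m k) n - 1 else top_y (m k) n"
      have "(\<Sum>k<s. ?b k) + 1 = (\<Sum>k<s. ?b k + (if k = j then 1 else 0))"
        using j(1) by (simp add: sum.distrib)
      also have "\<dots> = Y" unfolding Y_def using top_y_pos by (intro sum.cong) (auto simp: Suc_le_eq)
      finally have sum_b: "(\<Sum>k<s. ?b k) \<le> Poly_Mapping.lookup u 0" using u0 by simp
      have dead: "\<not> alive (m j) n" using j i(2) by (auto simp: set_js A_def)
      show ?thesis
      proof (rule prod_expsI[OF ue, where b = ?b])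
        show "(\<Sum>k<s. ?b k) \<le> Poly_Mapping.lookup (u + Poly_Mapping.single i 1) 0"
          using sum_b unfolding lk by simp
        fix k assume k: "k < s"
        have "2 * k + 2 \<noteq> 2 * j + 1" by presburger
        then show "piece (m k) n (Poly_Mapping.lookup (u + Poly_Mapping.single i 1) (2 * k + 2)) (?b k)
            (Poly_Mapping.lookup (u + Poly_Mapping.single i 1) (2 * k + 1))"
          using piece_top(1)[OF n, of "m k"] piece_top(3)[OF n dead] ut[OF k] ux[OF k] j(2)
          unfolding lk by (cases "k = j") auto
      qed
    next
      case (3 j)
      note j = 3
      let ?b = "\<lambda>k. if k = j then top_y (m k) n - 1 else top_y (m k) n"
      have "(\<Sum>k<s. ?b k) + 1 = (\<Sum>k<s. ?b k + (if k = j then 1 else 0))"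
        using j(1) by (simp add: sum.distrib)
      also have "\<dots> = Y" unfolding Y_def using top_y_pos by (intro sum.cong) (auto simp: Suc_le_eq)
      finally have sum_b: "(\<Sum>k<s. ?b k) \<le> Poly_Mapping.lookup u 0" using u0 by simp
      show ?thesis
      proof (rule prod_expsI[OF ue, where b = ?b])
        show "(\<Sum>k<s. ?b k) \<le> Poly_Mapping.lookup (u + Poly_Mapping.single i 1) 0"
          using sum_b unfolding lk by simp
        fix k assume k: "k < s"
        have "2 * k + 1 \<noteq> 2 * j + 2" by presburger
        then show "piece (m k) n (Poly_Mapping.lookup (u + Poly_Mapping.single i 1) (2 * k + 2)) (?b k)
            (Poly_Mapping.lookup (u + Poly_Mapping.single i 1) (2 * k + 1))"
          using piece_top(1)[OF n, of "m k"] piece_top(2)[OF n, of "m k"] ut[OF k] ux[OF k] j(2)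
          unfolding lk by (cases "k = j") auto
      qed
    qed
  qed
  have "depth_quot (2 * s + 1) (mon_span (prod_exps m s n) :: 'k mpoly set) = enat (length js)"
  proof (rule depth_quot_mon_span[OF exp_ideal_prod_exps _ _ _ _ u(1) merge_u u_notin killed])
    show "distinct js" using A by (simp add: js_def distinct_map inj_on_def)
    show "set js \<subseteq> {1..<2 * s + 1}" using A by (auto simp: set_js)
    show "separated (prod_exps m s n) P i" if P: "P \<subseteq> set js" and i: "i \<in> set js" for P i
    proof -
      obtain j where "i = 2 * j + 1" "j \<in> A" using i by (auto simp: set_js)
      moreover have "odd k" if "k \<in> P" for k using that P by (auto simp: set_js)
      ultimately show ?thesis using separated_prod_exps[of j s m n P] by (simp add: A_def)
    qed
  qed simp
  then show ?thesis by (simp add: js_def A_def)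
qed

theorem theorem4p9:
  fixes f :: "nat \<Rightarrow> nat"
  assumes "\<And>m n. 1 \<le> m \<Longrightarrow> m \<le> n \<Longrightarrow> f n \<le> f m"
  shows "\<exists>(N::nat) (Q :: 'k::field mpoly set).
           is_ideal N Q \<and> monomial_ideal N Q \<and>
           (\<forall>n\<ge>1. depth_quot N (ideal_pow N Q n) = enat (f n))"
proof -
  \<comment> \<open>All values of \<open>f\<close> are at most \<open>f 1\<close>, so this many
    blocks can realize them; the successor keeps one block even if \<open>f 1 = 0\<close>.\<close>
  define s where "s = Suc (f 1)"
  define m where "m j = (if \<exists>n\<ge>1. f n \<le> j then LEAST n. 1 \<le> n \<and> f n \<le> j else 0)" for j
  \<comment> \<open>Block \<open>j\<close> dies at the first \<open>n\<close> with
    \<open>f n \<le> j\<close> and stays dead because \<open>f\<close> does not increase; so the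
    number of alive blocks is \<open>f n\<close>.\<close>
  have alive: "alive (m j) n \<longleftrightarrow> j < f n" if n: "1 \<le> n" for j n
  proof (cases "\<exists>n\<ge>1. f n \<le> j")
    case True
    then have m: "m j = (LEAST n. 1 \<le> n \<and> f n \<le> j)" by (simp add: m_def)
    have mj: "1 \<le> m j \<and> f (m j) \<le> j" unfolding m by (rule LeastI_ex) (use True in blast)
    have "j < f n" if "n < m j" using not_less_Least[of n "\<lambda>n. 1 \<le> n \<and> f n \<le> j"] that n unfolding m by auto
    moreover have "f n \<le> j" if "m j \<le> n" using assms[of "m j" n] mj that by linarith
    ultimately show ?thesis using mj by (auto simp: alive_def not_less) (meson not_less)
  next
    case False
    then have "m j = 0" "j < f n" using n unfolding m_def by (metis, metis not_le)
    then show ?thesis by (simp add: alive_def)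
  qed
  let ?U = "prod_exps m s"
  let ?Q = "mon_span (?U 1) :: 'k mpoly set"
  have U1: "exp_ideal (2 * s + 1) (?U 1)" by (rule exp_ideal_prod_exps)
  have "monomial_ideal (2 * s + 1) ?Q"
    unfolding monomial_ideal_def using mon_span_eq_ideal_gen[OF U1] U1
    by (intro exI[of _ "?U 1"]) (auto simp: exp_ideal_def exps_def)
  moreover have "depth_quot (2 * s + 1) (ideal_pow (2 * s + 1) ?Q n) = enat (f n)" if n: "1 \<le> n" for n
  proof -
    have "ideal_pow (2 * s + 1) ?Q n = mon_span (?U n)"
      by (rule ideal_pow_mon_span[where U = ?U, OF exp_ideal_prod_exps prod_exps_0 prod_exps_Suc])
    moreover have "{j. j < s \<and> alive (m j) n} = {..<f n}"
      using assms[OF order_refl n] by (auto simp: alive[OF n] s_def)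
    ultimately show ?thesis
      using depth_quot_prod_exps[of s n m] n by (simp add: s_def)
  qed
  ultimately show ?thesis using mon_span_is_ideal[OF U1] by blast
qed

end
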